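(* Let $(\mathcal X,\mathcal S)$ be a hierarchically hyperbolic space with factor spaces $\{\mathcal C U\}_{U\in\mathcal S}$, projection maps $\lambda_U\colon\mathcal X\to\mathcal C U$ and consistency constraint sets $\mathcal R_{UV}\subseteq\mathcal C U\times\mathcal C V$. Let $$\mathcal Y=\Big\{(x_U)_U\in\prod_{U\in\mathcal S}\mathcal C U : (x_U,x_V)\in\mathcal R_{UV}\text{ for all distinct }U,V\in\mathcal S\Big\}$$ be the space of coarsely consistent tuples equipped with the $\ell^\infty$-metric. Then the product map $\prod_U\lambda_U$ induces a quasi-isometry $\mathcal X\to\mathrm{Rips}_\sigma\mathcal Y$ for $\sigma\ge0$ large.
   Context: General conventions. Metric spaces are extended (distances may be $\infty$) unless said otherwise. A space is quasigeodesic if it is quasi-isometric to a graph with its combinatorial metric. For $\sigma\ge0$, $\mathrm{Rips}_\sigma Y$ is the graph with vertex set $Y$ in which distinct $y,y'$ are adjacent iff $d(y,y')\le\sigma$, regarded as the metric space $(Y,d_\sigma)$ with $d_\sigma$ the combinatorial path metric on vertices. HHS. A hierarchically hyperbolic space (in the standard sense of Behrstock–Hagen–Sisto) consists of a quasigeodesic metric space $\mathcal X$ (with finite distances), called the total space, an index set $\mathcal S$, $\delta\ge 0$, and $\delta$-hyperbolic geodesic spaces $\mathcal C W$ $(W\in\mathcal S)$, called factor spaces, such that: (1) There are $\xi,K\ge 0$ and maps $\pi_W$ from $\mathcal X$ to nonempty subsets of $\mathcal C W$ of diameter $\le\xi$, each $(K,K)$-coarsely Lipschitz, with $\pi_W(\mathcal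 X)$ $K$-quasiconvex in $\mathcal C W$ (every geodesic of $\mathcal C W$ with endpoints in $\pi_W(\mathcal X)$ lies in the $K$-neighbourhood of $\pi_W(\mathcal X)$). (2) $\mathcal S$ has a partial order $\sqsubseteq$ (nesting), and is empty or has a unique $\sqsubseteq$-maximal element; $\mathcal S_W=\{V: V\sqsubseteq W\}$. For $V\sqsubsetneq W$ there are a nonempty subset $\rho^V_W\subseteq\mathcal C W$ of diameter $\le\xi$ and a map $\rho^W_V$ from $\mathcal C W$ to nonempty subsets of $\mathcal C V$. (3) $\mathcal S$ has a symmetric antireflexive relation $\perp$ (orthogonality): if $V\sqsubseteq W$ and $W\perp U$ then $V\perp U$; for each $T\in\mathcal S$ and $U\in\mathcal S_T$ with $\{V\in\mathcal S_T: V\perp U\}\ne\emptyset$ there is $W\in\mathcal S_T\setminus\{T\}$ such that $V\sqsubseteq W$ whenever $V\perp U$ and $V\sqsubseteq T$; if $V\perp W$ then $V,W$ are not $\sqsubseteq$-comparable. (4) Distinct $V,W$ which are neither orthogonal nor nested are transverse, $V\pitchfork W$. There is $\kappa_0\ge 0$ such that for $V\pitchfork W$ there are nonempty sets $\rho^V_W\subseteq\mathcal C W$, $\rho^W_V\subseteq\mathcal C V$ of diameter $\le\xi$ with $\min\{d_{\mathcal C W}(\pi_W(x),\rho^V_W),d_{\mathcal C V}(\pi_V(x),\rho^W_V)\}\le\kappa_0$ for all $x\in\mathcal X$; for $V\sqsubsetneq W$ and $x\in\mathcal X$, $\min\{d_{\mathcal C W}(\pi_W(x),\rho^V_W),\operatorname{diam}_{\mathcal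 C V}(\pi_V(x)\cup\rho^W_V(\pi_W(x)))\}\le\kappa_0$; and if $U\sqsubseteq V$ then $d_{\mathcal C W}(\rho^U_W,\rho^V_W)\le\kappa_0$ whenever $V\sqsubsetneq W$, or $V\pitchfork W$ and $W\not\perp U$. (5) There is $n$ such that any set of pairwise $\sqsubseteq$-comparable elements has at most $n$ elements. (6) There are $\ell\ge 1$, $E\ge\max\{\xi,\kappa_0\}$ such that for $W\in\mathcal S$, $x,x'\in\mathcal X$ and $N=\ell\, d_{\mathcal C W}(\pi_W(x),\pi_W(x'))+\ell$ there are at most $\lfloor N\rfloor$ elements $T_1,T_2,\dots\in\mathcal S_W\setminus\{W\}$ such that each $T\in\mathcal S_W\setminus\{W\}$ satisfies $T\sqsubseteq T_i$ for some $i$ or $d_{\mathcal C T}(\pi_T(x),\pi_T(x'))<E$; also $d_{\mathcal C W}(\pi_W(x),\rho^{T_i}_W)\le N$ for each $i$. (7) For $V\sqsubsetneq W$ and every geodesic $\gamma$ of $\mathcal C W$, either $\operatorname{diam}_{\mathcal C V}\rho^W_V(\gamma)\le E$ or $\gamma$ meets the $E$-neighbourhood of $\rho^V_W$. (8) There is $\alpha$ such that for any family $\{V_j\}$ of pairwise orthogonal elements and $p_j\in\pi_{V_j}(\mathcal X)$ there is $x\in\mathcal X$ with $d_{\mathcal C V_j}(\pi_{V_j}(x),p_j)\le\alpha$ for all $j$, and $d_{\mathcal C V}(\pi_V(x),\rho^{V_j}_V)\le\alpha$ whenever $V_j\sqsubsetneq V$ or $V\pitchfork V_j$. (9) (Uniqueness)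 For each $\kappa\ge 0$ there is $\theta(\kappa)$ such that $d(x,y)\ge\theta(\kappa)$ implies $d_{\mathcal C V}(\pi_V(x),\pi_V(y))\ge\kappa$ for some $V\in\mathcal S$. Choose $\lambda_U(x)\in\pi_U(x)$; the $\lambda_U\colon\mathcal X\to\mathcal C U$ are uniformly coarsely Lipschitz. Fix an error $\epsilon\ge 0$ large enough that $(\lambda_U x,\lambda_V x)\in\mathcal R_{UV}$ for all $x\in\mathcal X$ and distinct $U,V$, where $\mathcal R_{UV}\subseteq\mathcal C U\times\mathcal C V$ is the set of pairs $(x_U,x_V)$ with: $\min\{d_{\mathcal C U}(x_U,\rho^V_U),d_{\mathcal C V}(x_V,\rho^U_V)\}\le\epsilon$ if $U\pitchfork V$ (Behrstock inequality); $\min\{d_{\mathcal C V}(x_V,\rho^U_V),\operatorname{diam}_{\mathcal C U}(\{x_U\}\cup\rho^V_U(x_V))\}\le\epsilon$ if $U\sqsubsetneq V$ (bounded geodesic image inequality), and symmetrically if $V\sqsubsetneq U$; no condition if $U\perp V$. The product map $\prod_U\lambda_U$ sends $x\in\mathcal X$ to the tuple $(\lambda_U x)_U$, which lies in $\mathcal Y$.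
   Formalization: Assumes in addition that the projections π_W are uniformly coarsely surjective onto the factor spaces; without this the claim fails, e.g. for 𝒳 a point with single factor space ℝ and π_W(𝒳)={0}, where 𝒴=ℝ. *)

theory Defs
  imports "HOL-Analysis.Analysis"
begin

section \<open>Distances between sets, and diameters\<close>

text \<open>Both are taken in \<^typ>\<open>ennreal\<close>, so that the diameter of an unbounded set is infinite.\<close>

definition set_edist :: "('a \<Rightarrow> 'a \<Rightarrow> real) \<Rightarrow> 'a set \<Rightarrow> 'a set \<Rightarrow> ennreal" where
  "set_edist d A B = (INF a\<in>A. INF b\<in>B. ennreal (d a b))"

definition set_ediam :: "('a \<Rightarrow> 'a \<Rightarrow> real) \<Rightarrow> 'a set \<Rightarrow> ennreal" where
  "set_ediam d A = (SUP a\<in>A. SUP b\<in>A. ennreal (d a b))"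


section \<open>Geodesics and hyperbolicity\<close>

definition geodesic_segment ::
    "'a set \<Rightarrow> ('a \<Rightarrow> 'a \<Rightarrow> real) \<Rightarrow> 'a \<Rightarrow> 'a \<Rightarrow> 'a set \<Rightarrow> bool" where
  "geodesic_segment M d a b G \<longleftrightarrow> G \<subseteq> M \<and>
     (\<exists>L\<ge>0. \<exists>\<gamma>. \<gamma> 0 = a \<and> \<gamma> L = b \<and> \<gamma> ` {0..L} = G \<and>
        (\<forall>s\<in>{0..L}. \<forall>t\<in>{0..L}. d (\<gamma> s) (\<gamma> t) = \<bar>s - t\<bar>))"

text \<open>\<open>\<delta>\<close>-hyperbolicity is the slim triangles condition.\<close>

definition hyperbolic_geodesic_space ::
    "real \<Rightarrow> 'a set \<Rightarrow> ('a \<Rightarrow> 'a \<Rightarrow> real) \<Rightarrow> bool" where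
  "hyperbolic_geodesic_space \<delta> M d \<longleftrightarrow> Metric_space M d \<and>
     (\<forall>a\<in>M. \<forall>b\<in>M. \<exists>G. geodesic_segment M d a b G) \<and>
     (\<forall>a b c G1 G2 G3. geodesic_segment M d a b G1 \<longrightarrow> geodesic_segment M d b c G2 \<longrightarrow>
        geodesic_segment M d c a G3 \<longrightarrow> (\<forall>p\<in>G1. \<exists>q\<in>G2 \<union> G3. d p q \<le> \<delta>))"

definition quasiconvex ::
    "real \<Rightarrow> 'a set \<Rightarrow> ('a \<Rightarrow> 'a \<Rightarrow> real) \<Rightarrow> 'a set \<Rightarrow> bool" where
  "quasiconvex K M d A \<longleftrightarrow> A \<subseteq> M \<and>
     (\<forall>a\<in>A. \<forall>b\<in>A. \<forall>G. geodesic_segment M d a b G \<longrightarrow>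
        (\<forall>p\<in>G. set_edist d {p} A \<le> ennreal K))"


section \<open>Graphs, Rips graphs and quasi-isometries of extended metric spaces\<close>

text \<open>Extended metrics take values in \<^typ>\<open>ennreal\<close>.\<close>

definition simple_graph :: "'a set \<Rightarrow> ('a \<times> 'a) set \<Rightarrow> bool" where
  "simple_graph V edges \<longleftrightarrow> edges \<subseteq> V \<times> V \<and> sym edges \<and> irrefl edges"

text \<open>The combinatorial metric on vertices: the infimum of the lengths of the walks from \<open>x\<close> to
  \<open>y\<close>, which is infinite if there are none.\<close>

definition graph_dist :: "('a \<times> 'a) set \<Rightarrow> 'a \<Rightarrow> 'a \<Rightarrow> ennreal" where
  "graph_dist edges x y = (INF n\<in>{n. (x, y) \<in> edges ^^ n}. of_nat n)"

definition rips_edges ::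
    "real \<Rightarrow> 'a set \<Rightarrow> ('a \<Rightarrow> 'a \<Rightarrow> ennreal) \<Rightarrow> ('a \<times> 'a) set" where
  "rips_edges \<sigma> Y d = {(y, y'). y \<in> Y \<and> y' \<in> Y \<and> y \<noteq> y' \<and> d y y' \<le> ennreal \<sigma>}"

definition rips_dist ::
    "real \<Rightarrow> 'a set \<Rightarrow> ('a \<Rightarrow> 'a \<Rightarrow> ennreal) \<Rightarrow> 'a \<Rightarrow> 'a \<Rightarrow> ennreal" where
  "rips_dist \<sigma> Y d = graph_dist (rips_edges \<sigma> Y d)"

definition quasi_isometry ::
    "'a set \<Rightarrow> ('a \<Rightarrow> 'a \<Rightarrow> ennreal) \<Rightarrow> 'b set \<Rightarrow> ('b \<Rightarrow> 'b \<Rightarrow> ennreal) \<Rightarrow> ('a \<Rightarrow> 'b) \<Rightarrow> bool" where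
  "quasi_isometry M d N e f \<longleftrightarrow> f \<in> M \<rightarrow> N \<and>
     (\<exists>A\<ge>1. \<exists>B\<ge>0.
        (\<forall>x\<in>M. \<forall>y\<in>M. d x y / ennreal A - ennreal B \<le> e (f x) (f y) \<and>
                      e (f x) (f y) \<le> ennreal A * d x y + ennreal B) \<and>
        (\<forall>z\<in>N. \<exists>x\<in>M. e (f x) z \<le> ennreal B))"

text \<open>The type of the vertices of the graph is a parameter, because it cannot be quantified
  existentially.\<close>

definition quasigeodesic ::
    "'g itself \<Rightarrow> 'a set \<Rightarrow> ('a \<Rightarrow> 'a \<Rightarrow> ennreal) \<Rightarrow> bool" where
  "quasigeodesic _ M d \<longleftrightarrow>
     (\<exists>(V :: 'g set) edges f. simple_graph V edges \<and>
        quasi_isometry M d V (graph_dist edges) f)"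


section \<open>Hierarchically hyperbolic spaces\<close>

text \<open>The factor spaces are subsets \<open>\<C> W\<close> of one common type, each with its own metric.
  \<open>rho V W\<close> is the subset \<open>\<rho>\<^sup>V\<^sub>W\<close> of \<open>\<C> W\<close>, for \<open>V\<close> properly nested in \<open>W\<close> or transverse to it;
  \<open>rho_map W V\<close> is the map \<open>\<rho>\<^sup>W\<^sub>V\<close> from \<open>\<C> W\<close> to subsets of \<open>\<C> V\<close>, for \<open>V\<close> properly nested
  in \<open>W\<close>.\<close>

record ('x, 's, 'c) hhs_data =
  total_space :: "'x set" ("\<X>\<index>")
  total_dist :: "'x \<Rightarrow> 'x \<Rightarrow> real"
  domains :: "'s set" ("\<S>\<index>")
  factor :: "'s \<Rightarrow> 'c set" ("\<C>\<index>")
  factor_dist :: "'s \<Rightarrow> 'c \<Rightarrow> 'c \<Rightarrow> real" ("dist\<index>")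
  proj :: "'s \<Rightarrow> 'x \<Rightarrow> 'c set" ("\<pi>\<index>")
  nested :: "'s \<Rightarrow> 's \<Rightarrow> bool" (infix "\<sqsubseteq>\<index>" 50)
  orth :: "'s \<Rightarrow> 's \<Rightarrow> bool" (infix "\<perp>\<index>" 50)
  rho :: "'s \<Rightarrow> 's \<Rightarrow> 'c set" ("\<rho>\<index>")
  rho_map :: "'s \<Rightarrow> 's \<Rightarrow> 'c \<Rightarrow> 'c set" ("\<rho>map\<index>")

definition properly_nested ::
    "('x, 's, 'c, 'z) hhs_data_scheme \<Rightarrow> 's \<Rightarrow> 's \<Rightarrow> bool" (infix "\<sqsubset>\<index>" 50) where
  "V \<sqsubset>\<^bsub>H\<^esub> W \<longleftrightarrow> V \<sqsubseteq>\<^bsub>H\<^esub> W \<and> V \<noteq> W"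

definition transverse ::
    "('x, 's, 'c, 'z) hhs_data_scheme \<Rightarrow> 's \<Rightarrow> 's \<Rightarrow> bool" (infix "\<pitchfork>\<index>" 50) where
  "V \<pitchfork>\<^bsub>H\<^esub> W \<longleftrightarrow> V \<noteq> W \<and> \<not> V \<perp>\<^bsub>H\<^esub> W \<and> \<not> V \<sqsubseteq>\<^bsub>H\<^esub> W \<and> \<not> W \<sqsubseteq>\<^bsub>H\<^esub> V"

text \<open>\<open>proj_image H W\<close> is the set \<open>\<pi>\<^sub>W(\<X>)\<close>.\<close>

definition proj_image :: "('x, 's, 'c, 'z) hhs_data_scheme \<Rightarrow> 's \<Rightarrow> 'c set" where
  "proj_image H W = (\<Union>x\<in>total_space H. proj H W x)"

text \<open>The constants that occur in more than one axiom (and \<open>\<delta>\<close>) are parameters, the others are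
  existentially quantified.\<close>

locale hierarchically_hyperbolic_space =
  fixes graph_type :: "'g itself"
    and H :: "('x, 's, 'c, 'z) hhs_data_scheme" (structure)
    and \<delta> \<xi> \<kappa>\<^sub>0 E :: real
  assumes constants_nonneg: "\<delta> \<ge> 0" "\<xi> \<ge> 0" "\<kappa>\<^sub>0 \<ge> 0"
    and total_metric: "Metric_space \<X> (total_dist H)"
    and total_quasigeodesic:
      "quasigeodesic TYPE('g) \<X> (\<lambda>x y. ennreal (total_dist H x y))"
    and factor_hyperbolic: "\<And>W. W \<in> \<S> \<Longrightarrow> hyperbolic_geodesic_space \<delta> (\<C> W) (dist W)"
    and proj_nonempty: "\<And>W x. W \<in> \<S> \<Longrightarrow> x \<in> \<X> \<Longrightarrow> \<pi> W x \<noteq> {} \<and> \<pi> W x \<subseteq> \<C> W"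
    and proj_diam: "\<And>W x. W \<in> \<S> \<Longrightarrow> x \<in> \<X> \<Longrightarrow> set_ediam (dist W) (\<pi> W x) \<le> ennreal \<xi>"
    and proj_lipschitz_quasiconvex:
      "\<exists>K\<ge>0. \<forall>W\<in>\<S>.
         (\<forall>x\<in>\<X>. \<forall>y\<in>\<X>. set_edist (dist W) (\<pi> W x) (\<pi> W y)
                          \<le> ennreal (K * total_dist H x y + K)) \<and>
         quasiconvex K (\<C> W) (dist W) (proj_image H W)"
    and nested_partial_order: "reflp_on \<S> (\<sqsubseteq>)" "transp_on \<S> (\<sqsubseteq>)" "antisymp_on \<S> (\<sqsubseteq>)"
    and nested_maximal: "\<S> = {} \<or> (\<exists>!W. W \<in> \<S> \<and> (\<forall>V\<in>\<S>. W \<sqsubseteq> V \<longrightarrow> V = W))"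
    and rho_nested:
      "\<And>V W. V \<in> \<S> \<Longrightarrow> W \<in> \<S> \<Longrightarrow> V \<sqsubset> W \<Longrightarrow>
         \<rho> V W \<noteq> {} \<and> \<rho> V W \<subseteq> \<C> W \<and> set_ediam (dist W) (\<rho> V W) \<le> ennreal \<xi>"
    and rho_map_nested:
      "\<And>V W p. V \<in> \<S> \<Longrightarrow> W \<in> \<S> \<Longrightarrow> V \<sqsubset> W \<Longrightarrow> p \<in> \<C> W \<Longrightarrow>
         \<rho>map W V p \<noteq> {} \<and> \<rho>map W V p \<subseteq> \<C> V"
    and orth_sym_irrefl: "symp_on \<S> (\<perp>)" "irreflp_on \<S> (\<perp>)"
    and orth_nested:
      "\<And>U V W. U \<in> \<S> \<Longrightarrow> V \<in> \<S> \<Longrightarrow> W \<in> \<S> \<Longrightarrow> V \<sqsubseteq> W \<Longrightarrow> W \<perp> U \<Longrightarrow> V \<perp> U"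
    and orth_container:
      "\<And>T U. T \<in> \<S> \<Longrightarrow> U \<in> \<S> \<Longrightarrow> U \<sqsubseteq> T \<Longrightarrow> {V \<in> \<S>. V \<sqsubseteq> T \<and> V \<perp> U} \<noteq> {} \<Longrightarrow>
         \<exists>W\<in>\<S>. W \<sqsubset> T \<and> (\<forall>V\<in>\<S>. V \<perp> U \<and> V \<sqsubseteq> T \<longrightarrow> V \<sqsubseteq> W)"
    and orth_incomparable:
      "\<And>V W. V \<in> \<S> \<Longrightarrow> W \<in> \<S> \<Longrightarrow> V \<perp> W \<Longrightarrow> \<not> V \<sqsubseteq> W \<and> \<not> W \<sqsubseteq> V"
    and rho_transverse:
      "\<And>V W. V \<in> \<S> \<Longrightarrow> W \<in> \<S> \<Longrightarrow> V \<pitchfork> W \<Longrightarrow>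
         \<rho> V W \<noteq> {} \<and> \<rho> V W \<subseteq> \<C> W \<and> set_ediam (dist W) (\<rho> V W) \<le> ennreal \<xi>"
    and consistency_transverse:
      "\<And>V W x. V \<in> \<S> \<Longrightarrow> W \<in> \<S> \<Longrightarrow> V \<pitchfork> W \<Longrightarrow> x \<in> \<X> \<Longrightarrow>
         min (set_edist (dist W) (\<pi> W x) (\<rho> V W)) (set_edist (dist V) (\<pi> V x) (\<rho> W V))
           \<le> ennreal \<kappa>\<^sub>0"
    and consistency_nested:
      "\<And>V W x. V \<in> \<S> \<Longrightarrow> W \<in> \<S> \<Longrightarrow> V \<sqsubset> W \<Longrightarrow> x \<in> \<X> \<Longrightarrow>
         min (set_edist (dist W) (\<pi> W x) (\<rho> V W))
             (set_ediam (dist V) (\<pi> V x \<union> (\<Union>p\<in>\<pi> W x. \<rho>map W V p)))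
           \<le> ennreal \<kappa>\<^sub>0"
    and consistency_rho:
      "\<And>U V W. U \<in> \<S> \<Longrightarrow> V \<in> \<S> \<Longrightarrow> W \<in> \<S> \<Longrightarrow> U \<sqsubseteq> V \<Longrightarrow>
         V \<sqsubset> W \<or> (V \<pitchfork> W \<and> \<not> W \<perp> U) \<Longrightarrow>
         set_edist (dist W) (\<rho> U W) (\<rho> V W) \<le> ennreal \<kappa>\<^sub>0"
    and finite_complexity:
      "\<exists>n::nat. \<forall>A\<subseteq>\<S>. (\<forall>V\<in>A. \<forall>W\<in>A. V \<sqsubseteq> W \<or> W \<sqsubseteq> V) \<longrightarrow> finite A \<and> card A \<le> n"
    and E_ge: "E \<ge> max \<xi> \<kappa>\<^sub>0"
    and large_links:
      "\<exists>l\<ge>1. \<forall>W\<in>\<S>. \<forall>x\<in>\<X>. \<forall>x'\<in>\<X>.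
         let N = l * enn2real (set_edist (dist W) (\<pi> W x) (\<pi> W x')) + l in
         \<exists>F. F \<subseteq> {T \<in> \<S>. T \<sqsubset> W} \<and> finite F \<and> int (card F) \<le> \<lfloor>N\<rfloor> \<and>
             (\<forall>T\<in>\<S>. T \<sqsubset> W \<longrightarrow>
                (\<exists>T'\<in>F. T \<sqsubseteq> T') \<or> set_edist (dist T) (\<pi> T x) (\<pi> T x') < ennreal E) \<and>
             (\<forall>T'\<in>F. set_edist (dist W) (\<pi> W x) (\<rho> T' W) \<le> ennreal N)"
    and bounded_geodesic_image:
      "\<And>V W a b G. V \<in> \<S> \<Longrightarrow> W \<in> \<S> \<Longrightarrow> V \<sqsubset> W \<Longrightarrow> geodesic_segment (\<C> W) (dist W) a b G \<Longrightarrow>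
         set_ediam (dist V) (\<Union>p\<in>G. \<rho>map W V p) \<le> ennreal E \<or>
         (\<exists>p\<in>G. set_edist (dist W) {p} (\<rho> V W) \<le> ennreal E)"
    \<comment> \<open>The empty family is allowed, so the total space is nonempty.\<close>
    and partial_realisation:
      "\<exists>\<alpha>\<ge>0. \<forall>J p. J \<subseteq> \<S> \<longrightarrow> (\<forall>V\<in>J. \<forall>W\<in>J. V \<noteq> W \<longrightarrow> V \<perp> W) \<longrightarrow>
         (\<forall>V\<in>J. p V \<in> proj_image H V) \<longrightarrow>
         (\<exists>x\<in>\<X>. \<forall>V\<in>J. set_edist (dist V) (\<pi> V x) {p V} \<le> ennreal \<alpha> \<and>
            (\<forall>W\<in>\<S>. V \<sqsubset> W \<or> W \<pitchfork> V \<longrightarrow>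
               set_edist (dist W) (\<pi> W x) (\<rho> V W) \<le> ennreal \<alpha>))"
    and uniqueness:
      "\<And>\<kappa>. \<kappa> \<ge> 0 \<Longrightarrow> \<exists>\<theta>::real. \<forall>x\<in>\<X>. \<forall>y\<in>\<X>. total_dist H x y \<ge> \<theta> \<longrightarrow>
         (\<exists>V\<in>\<S>. set_edist (dist V) (\<pi> V x) (\<pi> V y) \<ge> ennreal \<kappa>)"

text \<open>The usual normalisation of a hierarchically hyperbolic space: the projections are uniformly
  coarsely surjective. It does not follow from the axioms above, which only ask for quasiconvex
  images: a single point with the one factor space \<open>\<real>\<close> satisfies them all.\<close>

definition normalised :: "('x, 's, 'c, 'z) hhs_data_scheme \<Rightarrow> bool" where
  "normalised H \<longleftrightarrow> (\<exists>r\<ge>0. \<forall>W\<in>domains H. \<forall>p\<in>factor H W.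
     set_edist (factor_dist H W) {p} (proj_image H W) \<le> ennreal r)"


section \<open>Coarsely consistent tuples\<close>

definition consistent_pairs ::
    "('x, 's, 'c, 'z) hhs_data_scheme \<Rightarrow> real \<Rightarrow> 's \<Rightarrow> 's \<Rightarrow> ('c \<times> 'c) set" where
  "consistent_pairs H \<epsilon> U V = {(p, q) \<in> factor H U \<times> factor H V.
     (U \<pitchfork>\<^bsub>H\<^esub> V \<longrightarrow> min (set_edist (factor_dist H U) {p} (rho H V U))
                     (set_edist (factor_dist H V) {q} (rho H U V)) \<le> ennreal \<epsilon>) \<and>
     (U \<sqsubset>\<^bsub>H\<^esub> V \<longrightarrow> min (set_edist (factor_dist H V) {q} (rho H U V))
                     (set_ediam (factor_dist H U) ({p} \<union> rho_map H V U q)) \<le> ennreal \<epsilon>) \<and>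
     (V \<sqsubset>\<^bsub>H\<^esub> U \<longrightarrow> min (set_edist (factor_dist H U) {p} (rho H V U))
                     (set_ediam (factor_dist H V) ({q} \<union> rho_map H U V p)) \<le> ennreal \<epsilon>)}"

definition consistent_tuples ::
    "('x, 's, 'c, 'z) hhs_data_scheme \<Rightarrow> real \<Rightarrow> ('s \<Rightarrow> 'c) set" where
  "consistent_tuples H \<epsilon> = {y \<in> PiE (domains H) (factor H).
     \<forall>U\<in>domains H. \<forall>V\<in>domains H. U \<noteq> V \<longrightarrow> (y U, y V) \<in> consistent_pairs H \<epsilon> U V}"

definition linf_dist ::
    "('x, 's, 'c, 'z) hhs_data_scheme \<Rightarrow> ('s \<Rightarrow> 'c) \<Rightarrow> ('s \<Rightarrow> 'c) \<Rightarrow> ennreal" where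
  "linf_dist H y z = (SUP U\<in>domains H. ennreal (factor_dist H U (y U) (z U)))"

definition product_map ::
    "('x, 's, 'c, 'z) hhs_data_scheme \<Rightarrow> ('s \<Rightarrow> 'x \<Rightarrow> 'c) \<Rightarrow> 'x \<Rightarrow> 's \<Rightarrow> 'c" where
  "product_map H lam x = (\<lambda>U\<in>domains H. lam U x)"

end

theory Submission
  imports Defs
begin

text \<open>The main point is that every consistent tuple \<open>b\<close> is coarsely realised by a point. Call a domain
  bad for \<open>x\<close> if the coordinates of \<open>x\<close> and \<open>b\<close> there are far apart. Among the \<open>\<sqsubseteq>\<close>-maximal bad
  domains, the transverse ones are ordered by Behrstock's inequality, and each has boundedly many
  predecessors by the passing up argument; a last one \<open>W\<close> is central for \<open>b\<close>: the coordinate \<open>b\<^sub>T\<close> is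
  close to \<open>\<rho>\<^sup>W\<^sub>T\<close> for every \<open>T\<close> that is transverse to \<open>W\<close> or properly contains it. Start with the
  empty family and take for \<open>x\<close> a partial realisation of \<open>b\<close> on an orthogonal family of central
  domains. A central bad domain is either orthogonal to the whole family, and is added to it, or
  properly nested in one member, and replaces it. By finite complexity this stops after a bounded
  number of steps, with no bad domains left.

  Given realisation, walks in the Rips graph of the tuples lift to coarse walks in the total space by
  the uniqueness axiom, and coarse walks in the quasigeodesic total space project to walks in the
  Rips graph because the projections are coarsely Lipschitz.\<close>

section \<open>Coarse projection systems\<close>

text \<open>The sets \<open>\<pi>\<^sub>W(x)\<close> and \<open>\<rho>\<^sup>V\<^sub>W\<close> are replaced by points \<open>pt x W\<close> and \<open>r V W\<close>, at the cost of
  enlarging the single constant \<open>c\<close>; the maps \<open>\<rho>\<^sup>W\<^sub>V\<close> enter only through \<open>geodesic_image\<close>.\<close>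

locale coarse_projections =
  fixes X :: "'x set" and S :: "'s set" and M :: "'s \<Rightarrow> 'c set"
    and d :: "'s \<Rightarrow> 'c \<Rightarrow> 'c \<Rightarrow> real"
    and below :: "'s \<Rightarrow> 's \<Rightarrow> bool" (infix "\<unlhd>" 50)
    and perp :: "'s \<Rightarrow> 's \<Rightarrow> bool" (infix "\<bottom>" 50)
    and r :: "'s \<Rightarrow> 's \<Rightarrow> 'c"
    and Y :: "('s \<Rightarrow> 'c) set" and pt :: "'x \<Rightarrow> 's \<Rightarrow> 'c"
    and ht :: "'s \<Rightarrow> nat" and n :: nat and c :: real
  assumes c_pos: "c \<ge> 1"
    and metric: "W \<in> S \<Longrightarrow> Metric_space (M W) (d W)"
    and tuple_in: "b \<in> Y \<Longrightarrow> W \<in> S \<Longrightarrow> b W \<in> M W"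
    and pt_tuple: "x \<in> X \<Longrightarrow> pt x \<in> Y"
    and below_refl: "V \<in> S \<Longrightarrow> V \<unlhd> V"
    and below_trans: "U \<in> S \<Longrightarrow> V \<in> S \<Longrightarrow> W \<in> S \<Longrightarrow> U \<unlhd> V \<Longrightarrow> V \<unlhd> W \<Longrightarrow> U \<unlhd> W"
    and below_antisym: "V \<in> S \<Longrightarrow> W \<in> S \<Longrightarrow> V \<unlhd> W \<Longrightarrow> W \<unlhd> V \<Longrightarrow> V = W"
    and top_exists: "S \<noteq> {} \<Longrightarrow> \<exists>U\<in>S. \<forall>V\<in>S. V \<unlhd> U"
    and perp_sym: "V \<in> S \<Longrightarrow> W \<in> S \<Longrightarrow> V \<bottom> W \<Longrightarrow> W \<bottom> V"
    and perp_below: "U \<in> S \<Longrightarrow> V \<in> S \<Longrightarrow> W \<in> S \<Longrightarrow> V \<unlhd> W \<Longrightarrow> W \<bottom> U \<Longrightarrow> V \<bottom> U"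
    and perp_not_below: "V \<in> S \<Longrightarrow> W \<in> S \<Longrightarrow> V \<bottom> W \<Longrightarrow> \<not> V \<unlhd> W"
    and ht_less: "V \<in> S \<Longrightarrow> W \<in> S \<Longrightarrow> V \<unlhd> W \<Longrightarrow> V \<noteq> W \<Longrightarrow> ht V < ht W"
    and ht_le: "V \<in> S \<Longrightarrow> ht V \<le> n"
    and card_perp: "J \<subseteq> S \<Longrightarrow> finite J \<Longrightarrow> pairwise (\<bottom>) J \<Longrightarrow> card J \<le> n"
    and r_in: "V \<in> S \<Longrightarrow> W \<in> S \<Longrightarrow> V \<noteq> W \<Longrightarrow> \<not> V \<bottom> W \<Longrightarrow> \<not> W \<unlhd> V \<Longrightarrow> r V W \<in> M W"
    and behrstock: "b \<in> Y \<Longrightarrow> V \<in> S \<Longrightarrow> W \<in> S \<Longrightarrow> V \<noteq> W \<Longrightarrow> \<not> V \<bottom> W \<Longrightarrow> \<not> V \<unlhd> W \<Longrightarrow>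
        \<not> W \<unlhd> V \<Longrightarrow> d W (b W) (r V W) \<le> c \<or> d V (b V) (r W V) \<le> c"
    and geodesic_image: "b \<in> Y \<Longrightarrow> b' \<in> Y \<Longrightarrow> V \<in> S \<Longrightarrow> W \<in> S \<Longrightarrow> V \<unlhd> W \<Longrightarrow> V \<noteq> W \<Longrightarrow>
        d V (b V) (b' V) \<le> c \<or> d W (b W) (r V W) \<le> d W (b W) (b' W) + c"
    and r_below: "U \<in> S \<Longrightarrow> V \<in> S \<Longrightarrow> W \<in> S \<Longrightarrow> U \<unlhd> V \<Longrightarrow>
        V \<noteq> W \<Longrightarrow> \<not> V \<bottom> W \<Longrightarrow> \<not> V \<unlhd> W \<Longrightarrow> \<not> W \<unlhd> V \<Longrightarrow>
        U \<noteq> W \<Longrightarrow> \<not> U \<bottom> W \<Longrightarrow> \<not> U \<unlhd> W \<Longrightarrow> \<not> W \<unlhd> U \<Longrightarrow> d W (r U W) (r V W) \<le> c"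
    and partial_realisation: "b \<in> Y \<Longrightarrow> J \<subseteq> S \<Longrightarrow> pairwise (\<bottom>) J \<Longrightarrow>
        \<exists>x\<in>X. \<forall>V\<in>J. d V (pt x V) (b V) \<le> c \<and>
          (\<forall>W\<in>S. V \<noteq> W \<and> \<not> V \<bottom> W \<and> \<not> W \<unlhd> V \<longrightarrow> d W (pt x W) (r V W) \<le> c)"
    and links: "x \<in> X \<Longrightarrow> x' \<in> X \<Longrightarrow> W \<in> S \<Longrightarrow>
        \<exists>F\<subseteq>{T \<in> S. T \<unlhd> W \<and> T \<noteq> W}. finite F \<and>
          real (card F) \<le> c * d W (pt x W) (pt x' W) + c \<and>
          (\<forall>T\<in>S. T \<unlhd> W \<and> T \<noteq> W \<longrightarrow>
             (\<exists>T'\<in>F. T \<unlhd> T') \<or> d T (pt x T) (pt x' T) \<le> c)"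
begin

definition below_strict :: "'s \<Rightarrow> 's \<Rightarrow> bool" (infix "\<lhd>" 50)
  where "V \<lhd> W \<longleftrightarrow> V \<unlhd> W \<and> V \<noteq> W"

definition crossing :: "'s \<Rightarrow> 's \<Rightarrow> bool" (infix "\<bowtie>" 50)
  where "V \<bowtie> W \<longleftrightarrow> V \<noteq> W \<and> \<not> V \<bottom> W \<and> \<not> V \<unlhd> W \<and> \<not> W \<unlhd> V"

lemma crossing_sym: "V \<in> S \<Longrightarrow> W \<in> S \<Longrightarrow> V \<bowtie> W \<Longrightarrow> W \<bowtie> V"
  using perp_sym by (auto simp: crossing_def)

text \<open>Orthogonal domains are incomparable, so the left side leaves exactly the two relations
  for which a point \<open>r V W\<close> is available. The assumptions \<open>r_in\<close> and
  \<open>partial_realisation\<close> use the left form, the arguments below the right one.\<close>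

lemma r_iff: "V \<in> S \<Longrightarrow> W \<in> S \<Longrightarrow>
    V \<noteq> W \<and> \<not> V \<bottom> W \<and> \<not> W \<unlhd> V \<longleftrightarrow> V \<lhd> W \<or> V \<bowtie> W"
  using perp_not_below below_antisym by (auto simp: crossing_def below_strict_def)

lemma r_mem: "V \<in> S \<Longrightarrow> W \<in> S \<Longrightarrow> V \<lhd> W \<or> V \<bowtie> W \<Longrightarrow> r V W \<in> M W"
  using r_iff r_in by blast

lemma pt_in: "x \<in> X \<Longrightarrow> W \<in> S \<Longrightarrow> pt x W \<in> M W"
  using pt_tuple tuple_in by blast

lemma behrstock_crossing: "b \<in> Y \<Longrightarrow> V \<in> S \<Longrightarrow> W \<in> S \<Longrightarrow> V \<bowtie> W \<Longrightarrow>
    d W (b W) (r V W) \<le> c \<or> d V (b V) (r W V) \<le> c"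
  using behrstock by (auto simp: crossing_def)

lemma d_commute: "W \<in> S \<Longrightarrow> d W p q = d W q p"
  using Metric_space.commute[OF metric] .

lemma d_triangle: "W \<in> S \<Longrightarrow> p \<in> M W \<Longrightarrow> q \<in> M W \<Longrightarrow> s \<in> M W \<Longrightarrow> d W p s \<le> d W p q + d W q s"
  using Metric_space.triangle[OF metric] .

lemma d_triangle': "W \<in> S \<Longrightarrow> p \<in> M W \<Longrightarrow> q \<in> M W \<Longrightarrow> s \<in> M W \<Longrightarrow> d W p s \<le> d W p q + d W s q"
  using d_triangle d_commute by metis

text \<open>The arguments are ordered so that coordinates come first and points such as
  \<open>r V W\<close> second, as Behrstock's inequality delivers them.\<close>

lemma d_triangle4:
  assumes "W \<in> S" "p \<in> M W" "q \<in> M W" "s \<in> M W" "t \<in> M W" "u \<in> M W"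
  shows "d W p u \<le> d W p q + d W s q + d W s t + d W u t"
  using assms d_triangle'[of W p q s] d_triangle[of W p s u] d_triangle'[of W s t u] by simp

lemma partial_realisation_crossing:
  assumes "b \<in> Y" "J \<subseteq> S" "pairwise (\<bottom>) J"
  shows "\<exists>x\<in>X. \<forall>V\<in>J. d V (pt x V) (b V) \<le> c \<and>
    (\<forall>W\<in>S. V \<lhd> W \<or> V \<bowtie> W \<longrightarrow> d W (pt x W) (r V W) \<le> c)"
proof -
  obtain x where x: "x \<in> X" "\<forall>V\<in>J. d V (pt x V) (b V) \<le> c \<and>
      (\<forall>W\<in>S. V \<noteq> W \<and> \<not> V \<bottom> W \<and> \<not> W \<unlhd> V \<longrightarrow> d W (pt x W) (r V W) \<le> c)"
    using partial_realisation[OF assms] by blast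
  have "\<forall>V\<in>J. d V (pt x V) (b V) \<le> c \<and>
      (\<forall>W\<in>S. V \<lhd> W \<or> V \<bowtie> W \<longrightarrow> d W (pt x W) (r V W) \<le> c)"
    using x(2) assms(2) r_iff by (metis subsetD)
  then show ?thesis using x(1) by blast
qed

text \<open>The point \<open>x\<close> stands in for the domain \<open>V\<close>: comparing with
  \<open>r V W\<close> becomes comparing with a point of \<open>X\<close>, to which
  \<open>links\<close> and Behrstock's inequality apply.\<close>

lemma partial_realisation_single:
  assumes "b \<in> Y" "V \<in> S"
  shows "\<exists>x\<in>X. \<forall>W\<in>S. V \<lhd> W \<or> V \<bowtie> W \<longrightarrow> d W (pt x W) (r V W) \<le> c"
  using partial_realisation_crossing[of b "{V}"] assms by (auto simp: pairwise_singleton)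

text \<open>Orthogonality to \<open>W\<close>, and nesting in \<open>W\<close>, would both pass from
  \<open>V\<close> down to \<open>U\<close>, contradicting that \<open>U\<close> crosses
  \<open>W\<close>.\<close>

lemma below_or_crossing:
  assumes "U \<in> S" "V \<in> S" "W \<in> S" "U \<unlhd> V" "U \<bowtie> W"
  shows "W \<lhd> V \<or> V \<bowtie> W"
  using assms below_trans perp_below unfolding crossing_def below_strict_def by blast

section \<open>Passing up\<close>

text \<open>Induction on the height of \<open>U\<close>. If some member of \<open>A\<close> lies
  properly below \<open>U\<close>, then \<open>x\<close> and \<open>x'\<close> are
  \<open>C\<close>-close on \<open>U\<close>, so \<open>links\<close> covers the members of
  \<open>A\<close> other than \<open>U\<close> by boundedly many domains of smaller height.\<close>

lemma passing_up_height:
  "\<exists>P. \<forall>U x x' A. U \<in> S \<longrightarrow> x \<in> X \<longrightarrow> x' \<in> X \<longrightarrow> A \<subseteq> {V \<in> S. V \<unlhd> U} \<longrightarrow> ht U \<le> k \<longrightarrow>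
     (\<forall>V\<in>A. c < d V (pt x V) (pt x' V)) \<longrightarrow>
     (\<forall>V\<in>A. \<forall>T\<in>S. V \<lhd> T \<longrightarrow> d T (pt x T) (pt x' T) \<le> C) \<longrightarrow>
     finite A \<and> card A \<le> P" (is "\<exists>P. ?bound k P")
proof (induction k)
  case 0
  have *: "finite A \<and> card A \<le> 1" if "U \<in> S" "ht U \<le> 0" "A \<subseteq> {V \<in> S. V \<unlhd> U}" for U A
  proof -
    have "A \<subseteq> {U}" using that ht_less by fastforce
    then show ?thesis
      using card_mono[of "{U}" A] finite_subset by auto
  qed
  show ?case by (intro exI[of _ 1] allI impI) (rule *)
next
  case (Suc k)
  then obtain P where P: "?bound k P" by (elim exE)
  \<comment> \<open>One for \<open>U\<close> itself, and at most \<open>P\<close> below each of the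
    at most \<open>c * C + c\<close> domains provided by \<open>links\<close>.\<close>
  define Q where "Q = Suc (nat \<lceil>c * C + c\<rceil> * P)"
  have *: "finite A \<and> card A \<le> Q"
    if U: "U \<in> S" "x \<in> X" "x' \<in> X" "A \<subseteq> {V \<in> S. V \<unlhd> U}" "ht U \<le> Suc k"
      and far: "\<forall>V\<in>A. c < d V (pt x V) (pt x' V)"
      and C: "\<forall>V\<in>A. \<forall>T\<in>S. V \<lhd> T \<longrightarrow> d T (pt x T) (pt x' T) \<le> C" for U x x' A
  proof (cases "A \<subseteq> {U}")
    case True
    then show ?thesis
      using card_mono[of "{U}" A] finite_subset by (auto simp: Q_def)
  next
    case False
    \<comment> \<open>Some member of \<open>A\<close> differs from \<open>U\<close>, hence is
      properly below it.\<close>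
    then have dU: "d U (pt x U) (pt x' U) \<le> C"
      using C U unfolding below_strict_def by blast
    obtain F where F: "F \<subseteq> {T \<in> S. T \<unlhd> U \<and> T \<noteq> U}" "finite F"
      "real (card F) \<le> c * d U (pt x U) (pt x' U) + c"
      "\<forall>T\<in>S. T \<unlhd> U \<and> T \<noteq> U \<longrightarrow> (\<exists>T'\<in>F. T \<unlhd> T') \<or> d T (pt x T) (pt x' T) \<le> c"
      using links[OF U(2,3,1)] by blast
    have "c * d U (pt x U) (pt x' U) \<le> c * C" using dU c_pos by simp
    then have cF: "card F \<le> nat \<lceil>c * C + c\<rceil>" using F(3) by linarith
    define B where "B T = {V \<in> A. V \<unlhd> T}" for T
    have B: "finite (B T) \<and> card (B T) \<le> P" if "T \<in> F" for T
    proof (rule P[THEN spec, THEN spec, THEN spec, THEN spec, THEN mp, THEN mp, THEN mp, THEN mp, THEN mp, THEN mp, THEN mp])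
      show "T \<in> S" "x \<in> X" "x' \<in> X" "B T \<subseteq> {V \<in> S. V \<unlhd> T}" using that F U by (auto simp: B_def)
      have "ht T < ht U" using that F U ht_less by blast
      then show "ht T \<le> k" using U by simp
      show "\<forall>V\<in>B T. c < d V (pt x V) (pt x' V)" using far by (simp add: B_def)
      show "\<forall>V\<in>B T. \<forall>T\<in>S. V \<lhd> T \<longrightarrow> d T (pt x T) (pt x' T) \<le> C" using C by (auto simp: B_def)
    qed
    have sub: "A \<subseteq> insert U (\<Union>T\<in>F. B T)"
    proof
      fix V assume V: "V \<in> A"
      show "V \<in> insert U (\<Union>T\<in>F. B T)"
      proof (cases "V = U")
        case False
        then have "\<exists>T'\<in>F. V \<unlhd> T'" using F(4) V U far by fastforce
        then show ?thesis using V by (auto simp: B_def)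
      qed simp
    qed
    have fin: "finite (\<Union>T\<in>F. B T)" using B F by blast
    have "card (\<Union>T\<in>F. B T) \<le> (\<Sum>T\<in>F. card (B T))" using F(2) by (rule card_UN_le)
    also have "\<dots> \<le> card F * P" using B sum_bounded_above[of F "\<lambda>T. card (B T)" P] by simp
    also have "\<dots> \<le> nat \<lceil>c * C + c\<rceil> * P" using cF by simp
    finally have "card (insert U (\<Union>T\<in>F. B T)) \<le> Q"
      using fin by (simp add: Q_def card_insert_if)
    moreover have "card A \<le> card (insert U (\<Union>T\<in>F. B T))"
      using sub fin by (intro card_mono) auto
    ultimately show ?thesis using sub fin finite_subset by fastforce
  qed
  show ?case by (intro exI[of _ Q] allI impI) (rule *)
qed

text \<open>The greatest domain contains all others and has height at most \<open>n\<close>.\<close>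

lemma passing_up:
  "\<exists>P. \<forall>x x' A. x \<in> X \<longrightarrow> x' \<in> X \<longrightarrow> A \<subseteq> S \<longrightarrow>
     (\<forall>V\<in>A. c < d V (pt x V) (pt x' V)) \<longrightarrow>
     (\<forall>V\<in>A. \<forall>T\<in>S. V \<lhd> T \<longrightarrow> d T (pt x T) (pt x' T) \<le> C) \<longrightarrow>
     finite A \<and> card A \<le> P"
proof (cases "S = {}")
  case True
  then show ?thesis by simp
next
  case False
  then obtain U where U: "U \<in> S" "\<forall>V\<in>S. V \<unlhd> U" using top_exists by blast
  then have U': "{V \<in> S. V \<unlhd> U} = S" "ht U \<le> n" using ht_le by blast+
  obtain P where P: "\<forall>U x x' A. U \<in> S \<longrightarrow> x \<in> X \<longrightarrow> x' \<in> X \<longrightarrow> A \<subseteq> {V \<in> S. V \<unlhd> U} \<longrightarrow> ht U \<le> n \<longrightarrow>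
     (\<forall>V\<in>A. c < d V (pt x V) (pt x' V)) \<longrightarrow>
     (\<forall>V\<in>A. \<forall>T\<in>S. V \<lhd> T \<longrightarrow> d T (pt x T) (pt x' T) \<le> C) \<longrightarrow>
     finite A \<and> card A \<le> P"
    using passing_up_height[of n C] by (elim exE)
  show ?thesis
    using P[THEN spec, of U] U(1) U' by (intro exI[of _ P]) simp
qed

section \<open>Central domains\<close>

definition bad :: "real \<Rightarrow> 'x \<Rightarrow> ('s \<Rightarrow> 'c) \<Rightarrow> 's set" where
  "bad D x b = {W \<in> S. D < d W (pt x W) (b W)}"

definition maximal_bad :: "real \<Rightarrow> 'x \<Rightarrow> ('s \<Rightarrow> 'c) \<Rightarrow> 's set" where
  "maximal_bad D x b = {W \<in> bad D x b. \<forall>T\<in>bad D x b. \<not> W \<lhd> T}"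

text \<open>The Behrstock ordering of the domains along which \<open>x\<close> and \<open>b\<close> are far apart, oriented
  towards \<open>b\<close>.\<close>

definition earlier :: "('s \<Rightarrow> 'c) \<Rightarrow> 's \<Rightarrow> 's \<Rightarrow> bool" where
  "earlier b V W \<longleftrightarrow> V \<bowtie> W \<and> d V (b V) (r W V) \<le> c"

text \<open>Coarse membership of \<open>b\<close> in the standard product region of
  \<open>V\<close>.\<close>

definition central :: "real \<Rightarrow> ('s \<Rightarrow> 'c) \<Rightarrow> 's \<Rightarrow> bool" where
  "central K b V \<longleftrightarrow> (\<forall>W\<in>S. V \<lhd> W \<or> V \<bowtie> W \<longrightarrow> d W (b W) (r V W) \<le> K)"

text \<open>Heights are bounded by \<open>n\<close>, so among the bad domains above \<open>W\<close>
  one has greatest height, and it is maximal.\<close>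

lemma bad_below_maximal:
  assumes "W \<in> bad D x b"
  obtains T where "T \<in> maximal_bad D x b" "W \<unlhd> T"
proof -
  define Q where "Q T \<longleftrightarrow> T \<in> bad D x b \<and> W \<unlhd> T" for T
  have S: "bad D x b \<subseteq> S" by (auto simp: bad_def)
  have "Q W" using assms S below_refl by (auto simp: Q_def)
  moreover have "\<forall>T. Q T \<longrightarrow> ht T < Suc n" using S ht_le by (auto simp: Q_def less_Suc_eq_le)
  ultimately obtain T where T: "Q T" "\<forall>T'. Q T' \<longrightarrow> ht T' \<le> ht T"
    using ex_has_greatest_nat[of Q W ht "Suc n"] by blast
  have "T \<in> maximal_bad D x b"
  proof (unfold maximal_bad_def, safe)
    show "T \<in> bad D x b" using T by (simp add: Q_def)
    fix T' assume T': "T' \<in> bad D x b" "T \<lhd> T'"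
    then have "Q T'" using T below_trans assms S unfolding Q_def below_strict_def by blast
    moreover have "ht T < ht T'" using T' T ht_less S unfolding Q_def below_strict_def by blast
    ultimately show False using T by fastforce
  qed
  then show ?thesis using that T by (auto simp: Q_def)
qed

section \<open>The Behrstock ordering of the maximal bad domains\<close>

context
  fixes x b D
  assumes x: "x \<in> X" and b: "b \<in> Y" and D: "4 * c \<le> D"
begin

lemma maximal_badD:
  assumes "W \<in> maximal_bad D x b"
  shows "W \<in> S" "D < d W (pt x W) (b W)"
    "\<And>T. T \<in> S \<Longrightarrow> W \<lhd> T \<Longrightarrow> d T (pt x T) (b T) \<le> D"
  using assms by (auto simp: maximal_bad_def bad_def not_less)

lemma maximal_bad_not_below:
  assumes "V \<in> maximal_bad D x b" "W \<in> maximal_bad D x b"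
  shows "\<not> V \<lhd> W"
  using assms by (auto simp: maximal_bad_def)

text \<open>On \<open>V\<close> the tuple \<open>b\<close> is near \<open>r W V\<close> and
  \<open>x\<close> is far from \<open>b\<close>, so \<open>x\<close> is far from
  \<open>r W V\<close>; Behrstock's inequality for \<open>x\<close> then places it near
  \<open>r V W\<close> on \<open>W\<close>.\<close>

lemma earlier_pt:
  assumes V: "V \<in> bad D x b" and W: "W \<in> S" and e: "earlier b V W"
  shows "d W (pt x W) (r V W) \<le> c"
proof (rule ccontr)
  assume n: "\<not> ?thesis"
  have S: "V \<in> S" "D < d V (pt x V) (b V)" using V by (auto simp: bad_def)
  have t: "V \<bowtie> W" "W \<bowtie> V" using e crossing_sym S W by (auto simp: earlier_def)
  have "d V (pt x V) (r W V) \<le> c"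
    using behrstock_crossing[OF pt_tuple[OF x] S(1) W t(1)] n by blast
  moreover have "d V (pt x V) (b V) \<le> d V (pt x V) (r W V) + d V (b V) (r W V)"
    using d_triangle' S W t r_mem pt_in x b tuple_in by simp
  ultimately show False using e S D c_pos unfolding earlier_def by linarith
qed

lemma earlier_total:
  assumes "V \<in> S" "W \<in> S" "V \<bowtie> W" "\<not> earlier b V W"
  shows "earlier b W V"
  using assms behrstock_crossing[OF b] crossing_sym by (auto simp: earlier_def)

text \<open>On \<open>V\<close>, \<open>x\<close> is near \<open>r U V\<close> and \<open>b\<close>
  near \<open>r W V\<close>, so these two points are far apart. A point of \<open>X\<close> near
  both would give a chain of four estimates by \<open>c\<close>, against
  \<open>4 * c \<le> D\<close>. Such points appear if \<open>U\<close> and \<open>W\<close> are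
  orthogonal; nesting is excluded by maximality.\<close>

lemma earlier_trans:
  assumes U: "U \<in> maximal_bad D x b" and V: "V \<in> maximal_bad D x b"
    and W: "W \<in> maximal_bad D x b" and UV: "earlier b U V" and VW: "earlier b V W"
  shows "earlier b U W"
proof -
  note m = maximal_badD[OF U] maximal_badD[OF V] maximal_badD[OF W]
  have bad: "U \<in> bad D x b" "V \<in> bad D x b" using U V by (auto simp: maximal_bad_def)
  have t: "U \<bowtie> V" "V \<bowtie> U" "V \<bowtie> W" "W \<bowtie> V" using UV VW crossing_sym m(1,4,7) by (auto simp: earlier_def)
  have mem: "pt x V \<in> M V" "b V \<in> M V" "r U V \<in> M V" "r W V \<in> M V"
    "pt x W \<in> M W" "b W \<in> M W" "r V W \<in> M W"
    using m(1,4,7) t x b pt_in tuple_in r_mem by auto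
  have xV: "d V (pt x V) (r U V) \<le> c" using earlier_pt[OF bad(1) m(4) UV] .
  have xW: "d W (pt x W) (r V W) \<le> c" using earlier_pt[OF bad(2) m(7) VW] .
  have bV: "d V (b V) (r W V) \<le> c" using VW by (simp add: earlier_def)
  \<comment> \<open>A point close to both \<open>r U V\<close> and \<open>r W V\<close> would
    connect \<open>x\<close> to \<open>b\<close> on \<open>V\<close>.\<close>
  have far: "False" if y: "y \<in> X" "d V (pt y V) (r U V) \<le> c" "d V (pt y V) (r W V) \<le> c" for y
  proof -
    have "d V (pt x V) (b V) \<le> d V (pt x V) (r U V) + d V (pt y V) (r U V) +
        d V (pt y V) (r W V) + d V (b V) (r W V)"
      using d_triangle4[OF m(4) mem(1,3) pt_in[OF y(1) m(4)] mem(4,2)] .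
    then show False using xV bV y D m(5) by linarith
  qed
  have "U \<noteq> W"
  proof
    assume "U = W"
    then have "d V (pt x V) (b V) \<le> 2 * c"
      using d_triangle'[OF m(4) mem(1,3,2)] xV bV by simp
    then show False using m(5) D c_pos by linarith
  qed
  moreover have "\<not> U \<bottom> W"
  proof
    assume o: "U \<bottom> W"
    then have "pairwise (\<bottom>) {U, W}" using perp_sym m(1,7) by (auto simp: pairwise_insert)
    then obtain y where y: "y \<in> X"
      "\<forall>V\<in>{U, W}. \<forall>T\<in>S. V \<lhd> T \<or> V \<bowtie> T \<longrightarrow> d T (pt y T) (r V T) \<le> c"
      using partial_realisation_crossing[OF b, of "{U, W}"] m(1,7) by auto
    show False using far[OF y(1)] y(2) t(1,4) m(4) by simp
  qed
  moreover have "\<not> U \<unlhd> W" "\<not> W \<unlhd> U"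
    using maximal_bad_not_below U W \<open>U \<noteq> W\<close> by (auto simp: below_strict_def)
  ultimately have UW: "U \<bowtie> W" by (simp add: crossing_def)
  show ?thesis
  proof (rule ccontr)
    assume "\<not> ?thesis"
    then have WU: "earlier b W U" using earlier_total[OF m(1,7) UW] by blast
    have memW: "r U W \<in> M W" using r_mem[OF m(1,7)] UW by blast
    obtain y where y: "y \<in> X"
      "\<forall>T\<in>S. U \<lhd> T \<or> U \<bowtie> T \<longrightarrow> d T (pt y T) (r U T) \<le> c"
      \<comment> \<open>On \<open>W\<close> this stand-in for \<open>U\<close> lies near
        \<open>r U W\<close>, hence near \<open>b\<close>. On \<open>V\<close> it is near
        \<open>r U V\<close>, so away from \<open>r W V\<close>, and Behrstock's inequality puts it
        near \<open>r V W\<close> on \<open>W\<close>, hence near \<open>x\<close>.\<close>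
      using partial_realisation_single[OF b m(1)] by blast
    have yV: "d V (pt y V) (r U V) \<le> c" and yW: "d W (pt y W) (r U W) \<le> c"
      using y(2) m(4,7) t(1) UW by simp_all
    have "\<not> d V (pt y V) (r W V) \<le> c" using far[OF y(1) yV] by blast
    then have yW': "d W (pt y W) (r V W) \<le> c"
      using behrstock_crossing[OF pt_tuple[OF y(1)] m(4,7) t(3)] by blast
    have "d W (pt x W) (b W) \<le> d W (pt x W) (r V W) + d W (pt y W) (r V W) +
        d W (pt y W) (r U W) + d W (b W) (r U W)"
      using d_triangle4[OF m(7) mem(5,7) pt_in[OF y(1) m(7)] memW mem(6)] .
    then show False using xW yW yW' WU D m(8) unfolding earlier_def by linarith
  qed
qed

text \<open>Passing up is applied to \<open>x\<close> and a stand-in \<open>y\<close> for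
  \<open>W\<close>. On an earlier \<open>V\<close>, \<open>y\<close> is near \<open>r W V\<close>
  and so near \<open>b\<close>, hence far from \<open>x\<close>. On every domain properly above
  \<open>V\<close>, \<open>x\<close> and \<open>y\<close> are close.\<close>

lemma finite_earlier:
  obtains P where "\<And>W. W \<in> maximal_bad D x b \<Longrightarrow>
    finite {V \<in> maximal_bad D x b. earlier b V W} \<and>
    card {V \<in> maximal_bad D x b. earlier b V W} \<le> P"
proof -
  obtain P where P: "\<forall>x x' A. x \<in> X \<longrightarrow> x' \<in> X \<longrightarrow> A \<subseteq> S \<longrightarrow>
     (\<forall>V\<in>A. c < d V (pt x V) (pt x' V)) \<longrightarrow>
     (\<forall>V\<in>A. \<forall>T\<in>S. V \<lhd> T \<longrightarrow> d T (pt x T) (pt x' T) \<le> D + 3 * c) \<longrightarrow>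
     finite A \<and> card A \<le> P"
    \<comment> \<open>The distance from \<open>x\<close> to \<open>r W T\<close> contributes
      \<open>D + 2 * c\<close>, that from \<open>y\<close> to \<open>r W T\<close> a further
      \<open>c\<close>.\<close>
    using passing_up[of "D + 3 * c"] by (elim exE)
  have "finite {V \<in> maximal_bad D x b. earlier b V W} \<and>
    card {V \<in> maximal_bad D x b. earlier b V W} \<le> P" if W: "W \<in> maximal_bad D x b" for W
  proof -
    note mW = maximal_badD[OF W]
    obtain y where y: "y \<in> X"
      "\<forall>T\<in>S. W \<lhd> T \<or> W \<bowtie> T \<longrightarrow> d T (pt y T) (r W T) \<le> c"
      using partial_realisation_single[OF b mW(1)] by blast
    show ?thesis
    proof (rule P[rule_format, OF x y(1)])
      show "{V \<in> maximal_bad D x b. earlier b V W} \<subseteq> S" by (auto simp: maximal_bad_def bad_def)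
    next
      fix V assume "V \<in> {V \<in> maximal_bad D x b. earlier b V W}"
      then have V: "V \<in> maximal_bad D x b" and e: "earlier b V W" by auto
      note mV = maximal_badD[OF V]
      have t: "V \<bowtie> W" "W \<bowtie> V" using e crossing_sym mV(1) mW(1) by (auto simp: earlier_def)
      have mem: "pt x V \<in> M V" "b V \<in> M V" "r W V \<in> M V" "pt y V \<in> M V"
        using mV(1) mW(1) t x b y(1) pt_in tuple_in r_mem by auto
      have "d V (pt y V) (r W V) \<le> c" using y(2) mV(1) t(2) by simp
      moreover have "d V (b V) (r W V) \<le> c" using e by (simp add: earlier_def)
      moreover have "d V (pt y V) (b V) \<le> d V (pt y V) (r W V) + d V (b V) (r W V)"
        using d_triangle'[OF mV(1) mem(4,3,2)] .
      moreover have "d V (pt x V) (b V) \<le> d V (pt x V) (pt y V) + d V (pt y V) (b V)"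
        using d_triangle[OF mV(1) mem(1,4,2)] .
      ultimately show "c < d V (pt x V) (pt y V)" using mV(2) D c_pos by linarith
      fix T assume T: "T \<in> S" "V \<lhd> T"
      have good: "d T (pt x T) (b T) \<le> D" using mV(3)[OF T] .
      have "T \<noteq> W" using T t by (auto simp: crossing_def below_strict_def)
      then consider "W \<lhd> T" | "T \<bowtie> W"
        using below_or_crossing[of V T W] T mV(1) mW(1) t by (auto simp: below_strict_def)
      \<comment> \<open>Since \<open>V\<close> is maximal bad, \<open>x\<close> and \<open>b\<close>
        are \<open>D\<close>-close on \<open>T\<close>. If \<open>W\<close> is below
        \<open>T\<close>, the geodesic image bound applies, as \<open>x\<close> and \<open>b\<close>
        are far apart on \<open>W\<close>. If \<open>T\<close> crosses \<open>W\<close>, a large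
        distance to \<open>r W T\<close> for both \<open>x\<close> and \<open>b\<close> would force
        both near \<open>r T W\<close>, hence close on \<open>W\<close>.\<close>
      then have rT: "d T (pt x T) (r W T) \<le> D + 2 * c" and tT: "W \<lhd> T \<or> W \<bowtie> T"
      proof (atomize(full), cases)
        case 1
        then have "d T (pt x T) (r W T) \<le> d T (pt x T) (b T) + c"
          using geodesic_image[OF pt_tuple[OF x] b mW(1) T(1)] mW(2) D c_pos
          unfolding below_strict_def by fastforce
        then show "d T (pt x T) (r W T) \<le> D + 2 * c \<and> (W \<lhd> T \<or> W \<bowtie> T)"
          using good 1 c_pos by simp
      next
        case 2
        then have t': "W \<bowtie> T" using crossing_sym T mW(1) by blast
        have mem': "pt x T \<in> M T" "b T \<in> M T" "r W T \<in> M T" "pt x W \<in> M W" "b W \<in> M W" "r T W \<in> M W"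
          using mW(1) T(1) t' 2 x b pt_in tuple_in r_mem by auto
        have "d T (pt x T) (r W T) \<le> D + 2 * c"
        proof (rule ccontr)
          assume n: "\<not> ?thesis"
          have "d T (pt x T) (r W T) \<le> d T (pt x T) (b T) + d T (b T) (r W T)"
            using d_triangle[OF T(1) mem'(1,2,3)] .
          then have "\<not> d T (b T) (r W T) \<le> c" "\<not> d T (pt x T) (r W T) \<le> c"
            using n good c_pos D by linarith+
          then have "d W (pt x W) (r T W) \<le> c" "d W (b W) (r T W) \<le> c"
            using behrstock_crossing[OF pt_tuple[OF x] T(1) mW(1) 2] behrstock_crossing[OF b T(1) mW(1) 2]
            by blast+
          then show False
            using d_triangle'[OF mW(1) mem'(4,6,5)] mW(2) D c_pos by linarith
        qed
        then show "d T (pt x T) (r W T) \<le> D + 2 * c \<and> (W \<lhd> T \<or> W \<bowtie> T)"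
          using t' by simp
      qed
      have "d T (pt x T) (pt y T) \<le> d T (pt x T) (r W T) + d T (pt y T) (r W T)"
        using d_triangle'[OF T(1) pt_in[OF x T(1)] r_mem[OF mW(1) T(1) tT] pt_in[OF y(1) T(1)]] .
      then show "d T (pt x T) (pt y T) \<le> D + 3 * c" using y(2) T(1) tT rT by fastforce
    qed
  qed
  then show ?thesis using that by blast
qed

text \<open>The domain with the most predecessors works: if it preceded some \<open>V\<close>,
  transitivity would give \<open>V\<close> all its predecessors and itself.\<close>

lemma last_maximal_bad:
  assumes "bad D x b \<noteq> {}"
  obtains W where "W \<in> maximal_bad D x b"
    "\<And>V. V \<in> maximal_bad D x b \<Longrightarrow> V \<bowtie> W \<Longrightarrow> earlier b V W"
proof -
  define pred where "pred W = {V \<in> maximal_bad D x b. earlier b V W}" for W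
  obtain P where P: "\<And>W. W \<in> maximal_bad D x b \<Longrightarrow> finite (pred W) \<and> card (pred W) \<le> P"
    using finite_earlier unfolding pred_def by blast
  obtain W0 where "W0 \<in> maximal_bad D x b" using assms bad_below_maximal by blast
  then obtain W where W: "W \<in> maximal_bad D x b"
    and W_max: "\<forall>V. V \<in> maximal_bad D x b \<longrightarrow> card (pred V) \<le> card (pred W)"
    using ex_has_greatest_nat[of "\<lambda>W. W \<in> maximal_bad D x b" W0 "\<lambda>W. card (pred W)" "Suc P"] P
    by (auto simp: less_Suc_eq_le)
  have "earlier b V W" if V: "V \<in> maximal_bad D x b" "V \<bowtie> W" for V
  proof (rule ccontr)
    assume "\<not> ?thesis"
    then have e: "earlier b W V" using earlier_total V W maximal_badD(1) by blast
    have "earlier b U V" if "U \<in> pred W" for U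
      using earlier_trans[OF _ W V(1) _ e] that by (simp add: pred_def)
    then have "insert W (pred W) \<subseteq> pred V"
      using W e by (auto simp: pred_def)
    moreover have "W \<notin> pred W" by (simp add: pred_def earlier_def crossing_def)
    ultimately have "card (pred W) < card (pred V)"
      using P[OF W] P[OF V(1)] by (intro psubset_card_mono) auto
    then show False using W_max V by fastforce
  qed
  then show ?thesis using that W by blast
qed

text \<open>The last maximal bad domain \<open>W\<close> is central. A larger domain is good, so the
  geodesic image bound applies. For a crossing \<open>T\<close>, failure of the estimate forces
  \<open>b\<close> near \<open>r T W\<close> on \<open>W\<close>; it remains to bring
  \<open>x\<close> near \<open>r T W\<close> as well.\<close>

lemma central_bad:
  assumes "bad D x b \<noteq> {}"
  obtains W where "W \<in> bad D x b" "central (D + 2 * c) b W"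
proof -
  obtain W where W: "W \<in> maximal_bad D x b"
    and last: "\<And>V. V \<in> maximal_bad D x b \<Longrightarrow> V \<bowtie> W \<Longrightarrow> earlier b V W"
    using last_maximal_bad assms by blast
  note mW = maximal_badD[OF W]
  have "d T (b T) (r W T) \<le> D + 2 * c" if T: "T \<in> S" and rel: "W \<lhd> T \<or> W \<bowtie> T" for T
    using rel
  proof
    assume less: "W \<lhd> T"
    have "d T (b T) (pt x T) \<le> D" using mW(3)[OF T less] d_commute[OF T] by metis
    moreover have "\<not> d W (b W) (pt x W) \<le> c" using mW(2) D c_pos d_commute[OF mW(1), of "b W"] by simp
    ultimately show ?thesis
      using geodesic_image[OF b pt_tuple[OF x] mW(1) T] less c_pos
      unfolding below_strict_def by fastforce
  next
    assume t': "W \<bowtie> T"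
    then have t: "T \<bowtie> W" using crossing_sym T mW(1) by blast
    have mem: "pt x T \<in> M T" "b T \<in> M T" "r W T \<in> M T" "pt x W \<in> M W" "b W \<in> M W" "r T W \<in> M W"
      using mW(1) T t t' x b pt_in tuple_in r_mem by auto
    show ?thesis
    proof (rule ccontr)
      assume n: "\<not> ?thesis"
      then have bW: "d W (b W) (r T W) \<le> c"
        using behrstock_crossing[OF b T mW(1) t] D c_pos by auto
      show False
      proof (cases "T \<in> bad D x b")
        case False
        \<comment> \<open>Here \<open>x\<close> is close enough to \<open>b\<close> on
          \<open>T\<close> to be far from \<open>r W T\<close> too.\<close>
        then have good: "d T (pt x T) (b T) \<le> D" using T by (auto simp: bad_def)
        have "d T (b T) (r W T) \<le> d T (pt x T) (b T) + d T (pt x T) (r W T)"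
          using d_triangle[OF T mem(2,1,3)] d_commute[OF T] by metis
        then have "\<not> d T (pt x T) (r W T) \<le> c" using n good c_pos by linarith
        then have "d W (pt x W) (r T W) \<le> c"
          using behrstock_crossing[OF pt_tuple[OF x] T mW(1) t] by blast
        then show False
          using d_triangle'[OF mW(1) mem(4,6,5)] bW mW(2) D c_pos by linarith
      next
        case True
        then obtain T' where T': "T' \<in> maximal_bad D x b" "T \<unlhd> T'"
          using bad_below_maximal by blast
        note mT' = maximal_badD[OF T'(1)]
        \<comment> \<open>The case of \<open>W\<close> below \<open>T'\<close> is excluded by
          maximality of \<open>W\<close>. So \<open>T'\<close> precedes \<open>W\<close>, which
          places \<open>x\<close> near \<open>r T' W\<close>.\<close>
        have t2: "T' \<bowtie> W"
          using below_or_crossing[OF T mT'(1) mW(1) T'(2) t] maximal_bad_not_below W T' by blast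
        have x': "d W (pt x W) (r T' W) \<le> c"
          using earlier_pt[OF _ mW(1) last[OF T'(1) t2]] T' by (simp add: maximal_bad_def)
        have "d W (r T W) (r T' W) \<le> c"
          using r_below[OF T mT'(1) mW(1) T'(2)] t2 t by (simp add: crossing_def)
        \<comment> \<open>Using \<open>r T W\<close> twice makes the third summand zero, leaving at
          most \<open>3 * c\<close>.\<close>
        moreover have "d W (pt x W) (b W) \<le> d W (pt x W) (r T' W) + d W (r T W) (r T' W) +
            d W (r T W) (r T W) + d W (b W) (r T W)"
          using d_triangle4[OF mW(1) mem(4) r_mem[OF mT'(1) mW(1)] mem(6) mem(6) mem(5)] t2 by blast
        moreover have "d W (r T W) (r T W) = 0"
          using Metric_space.mdist_zero[OF metric[OF mW(1)] mem(6)] .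
        ultimately show False using x' bW mW(2) D c_pos by linarith
      qed
    qed
  qed
  then have "central (D + 2 * c) b W" by (simp add: central_def)
  moreover have "W \<in> bad D x b" using W by (simp add: maximal_bad_def)
  ultimately show ?thesis by (intro that)
qed

end

section \<open>Realisation of consistent tuples\<close>

text \<open>Strictly decreases when a domain is added to an orthogonal family or one of its members is
  replaced by a domain properly nested in it, since \<open>ht\<close> and the cardinality of such families are
  bounded by \<open>n\<close>.\<close>

definition potential :: "'s set \<Rightarrow> nat" where
  "potential J = (\<Sum>V\<in>J. ht V) + (n - card J) * Suc n"

text \<open>Each round lowers the potential and raises the constant of centrality from
  \<open>K\<close> to \<open>K + 6 * c\<close>, hence the term \<open>6 * c * real k\<close>. The
  final \<open>4 * c\<close> comes from the threshold \<open>D\<close> of the round without bad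
  domains.\<close>

lemma realisation_family:
  assumes b: "b \<in> Y" and "J \<subseteq> S" "finite J" "pairwise (\<bottom>) J"
    and "\<And>V. V \<in> J \<Longrightarrow> central K b V" and "0 \<le> K" and "potential J \<le> k"
  shows "\<exists>x\<in>X. \<forall>W\<in>S. d W (pt x W) (b W) \<le> K + 4 * c + 6 * c * real k"
  using assms(2-)
proof (induction k arbitrary: J K rule: less_induct)
  case (less k)
  obtain x where x: "x \<in> X" "\<forall>V\<in>J. d V (pt x V) (b V) \<le> c"
    "\<forall>V\<in>J. \<forall>W\<in>S. V \<lhd> W \<or> V \<bowtie> W \<longrightarrow> d W (pt x W) (r V W) \<le> c"
    using partial_realisation_crossing[OF b less.prems(1,3)] by blast
  define D where "D = K + 4 * c"
  show ?case
  proof (cases "bad D x b = {}")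
    case True
    then have "\<forall>W\<in>S. d W (pt x W) (b W) \<le> D" by (auto simp: bad_def not_less)
    moreover have "D \<le> K + 4 * c + 6 * c * real k" using c_pos by (simp add: D_def)
    ultimately show ?thesis using x(1) by (meson order_trans)
  next
    case False
    then obtain W where W: "W \<in> bad D x b" "central (D + 2 * c) b W"
      using central_bad[OF x(1) b, of D] less.prems(5) by (auto simp: D_def)
    have WS: "W \<in> S" and far: "D < d W (pt x W) (b W)" using W by (auto simp: bad_def)
    have cW: "central (K + 6 * c) b W" using W(2) by (simp add: D_def algebra_simps)
    have cJ: "central (K + 6 * c) b V" if "V \<in> J" for V
      using less.prems(4)[OF that] c_pos unfolding central_def by fastforce
    \<comment> \<open>On members of \<open>J\<close>, \<open>x\<close> is within \<open>c\<close> of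
      \<open>b\<close>, so \<open>W\<close> is none of them. If \<open>W\<close> were above or
      crossing \<open>V\<close>, both \<open>x\<close> and \<open>b\<close> would be near
      \<open>r V W\<close> on \<open>W\<close>, with total error at most \<open>K + c\<close>, less
      than \<open>D\<close>.\<close>
    have rel: "W \<lhd> V \<or> V \<bottom> W" if V: "V \<in> J" for V
    proof -
      have VS: "V \<in> S" using V less.prems by blast
      have "V \<noteq> W" using x(2) V far less.prems(5) c_pos by (auto simp: D_def)
      moreover have "\<not> (V \<lhd> W \<or> V \<bowtie> W)"
      proof
        assume a: "V \<lhd> W \<or> V \<bowtie> W"
        then have "d W (b W) (r V W) \<le> K" "d W (pt x W) (r V W) \<le> c"
          using less.prems(4)[OF V] x(3) V WS by (auto simp: central_def)
        moreover have "d W (pt x W) (b W) \<le> d W (pt x W) (r V W) + d W (b W) (r V W)"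
          using d_triangle' WS pt_in x tuple_in b r_mem VS a by simp
        ultimately show False using far c_pos by (simp add: D_def)
      qed
      ultimately show ?thesis by (auto simp: crossing_def below_strict_def)
    qed
    have "\<exists>J'. J' \<subseteq> S \<and> finite J' \<and> pairwise (\<bottom>) J' \<and> J' \<subseteq> insert W J \<and> potential J' < potential J"
    proof (cases "\<exists>V\<in>J. W \<lhd> V")
      case True
      then obtain V where V: "V \<in> J" "W \<lhd> V" by blast
      have VS: "V \<in> S" using V less.prems by blast
      \<comment> \<open>\<open>W\<close> inherits from \<open>V\<close> the orthogonality to the
        other members, so replacing \<open>V\<close> keeps the family orthogonal.\<close>
      have ort: "W \<bottom> U" if "U \<in> J - {V}" for U
      proof -
        have "V \<bottom> U" using that V less.prems(3) by (auto simp: pairwise_def)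
        then show ?thesis using perp_below[of U W V] that V WS VS less.prems(1)
          by (auto simp: below_strict_def)
      qed
      have "W \<notin> J - {V}" using ort perp_not_below WS below_refl by blast
      then have card: "card (insert W (J - {V})) = card J"
        using less.prems(2) V by (metis card.insert finite_Diff card.remove)
      have "pairwise (\<bottom>) (insert W (J - {V}))"
        using less.prems(1,3) ort perp_sym WS
        by (auto simp: pairwise_insert intro: pairwise_subset)
      moreover have "(\<Sum>U\<in>insert W (J - {V}). ht U) < (\<Sum>U\<in>J. ht U)"
        using ht_less[of W V] WS VS V less.prems(2) \<open>W \<notin> J - {V}\<close>
        by (simp add: sum.remove[of J V] below_strict_def)
      then have "potential (insert W (J - {V})) < potential J"
        using card by (simp add: potential_def)
      ultimately show ?thesis
        using less.prems(1,2) WS by (intro exI[of _ "insert W (J - {V})"]) auto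
    next
      case False
      then have ort: "U \<bottom> W" if "U \<in> J" for U using rel that by blast
      have nin: "W \<notin> J" using ort perp_not_below WS below_refl by blast
      have pw: "pairwise (\<bottom>) (insert W J)"
        using less.prems(1,3) ort perp_sym WS by (auto simp: pairwise_insert)
      have "card (insert W J) \<le> n" using card_perp pw less.prems(1,2) WS by simp
      then have "Suc (card J) \<le> n" using nin less.prems(2) by simp
      \<comment> \<open>The second summand of the potential drops by \<open>Suc n\<close>, while the
        new height adds at most \<open>n\<close>.\<close>
      then have "(n - card J) * Suc n = (n - Suc (card J)) * Suc n + Suc n"
        by (metis Suc_diff_le add.commute diff_Suc_Suc mult_Suc)
      then have "potential (insert W J) < potential J"
        using ht_le[OF WS] nin less.prems(2) by (simp add: potential_def)
      then show ?thesis
        using pw less.prems(1,2) WS by (intro exI[of _ "insert W J"]) auto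
    qed
    then obtain J' where J': "J' \<subseteq> S" "finite J'" "pairwise (\<bottom>) J'" "J' \<subseteq> insert W J"
      "potential J' < potential J" by blast
    then have "potential J' < k" using less.prems(6) by simp
    moreover have "central (K + 6 * c) b V" if "V \<in> J'" for V using that J'(4) cW cJ by blast
    moreover have "0 \<le> K + 6 * c" using less.prems c_pos by simp
    ultimately obtain x' where x': "x' \<in> X"
      "\<forall>W\<in>S. d W (pt x' W) (b W) \<le> K + 6 * c + 4 * c + 6 * c * real (potential J')"
      using less.IH[of "potential J'" J' "K + 6 * c"] J' by blast
    have "6 * c * real (Suc (potential J')) \<le> 6 * c * real k"
      using \<open>potential J' < k\<close> c_pos by (intro mult_left_mono) auto
    then have "K + 6 * c + 4 * c + 6 * c * real (potential J') \<le> K + 4 * c + 6 * c * real k"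
      by (simp add: algebra_simps)
    then show ?thesis using x' by (meson order_trans)
  qed
qed

theorem realisation:
  "\<exists>\<Theta>\<ge>0. \<forall>b\<in>Y. \<exists>x\<in>X. \<forall>W\<in>S. d W (pt x W) (b W) \<le> \<Theta>"
proof (intro exI conjI ballI)
  \<comment> \<open>The empty family is vacuously central with \<open>K = 0\<close> and has
    potential \<open>n * Suc n\<close>.\<close>
  show "0 \<le> 0 + 4 * c + 6 * c * real (n * Suc n)" using c_pos by simp
  fix b assume b: "b \<in> Y"
  show "\<exists>x\<in>X. \<forall>W\<in>S. d W (pt x W) (b W) \<le> 0 + 4 * c + 6 * c * real (n * Suc n)"
  proof (rule realisation_family[OF b])
    show "potential {} \<le> n * Suc n"
      unfolding potential_def by (simp only: sum.empty card.empty diff_zero add_0 order.refl)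
    show "{} \<subseteq> S" "finite {}" "pairwise (\<bottom>) {}" "(0::real) \<le> 0"
      by (simp_all add: pairwise_def)
    show "central 0 b V" if "V \<in> {}" for V using that by blast
  qed
qed

end

section \<open>Distances between sets and points\<close>

lemma set_edist_lessD:
  assumes "set_edist d A B < ennreal R"
  shows "\<exists>a\<in>A. \<exists>b\<in>B. d a b < R"
proof -
  obtain a b where "a \<in> A" "b \<in> B" "ennreal (d a b) < ennreal R"
    using assms by (auto simp: set_edist_def INF_less_iff)
  then show ?thesis by (metis ennreal_leI not_less)
qed

text \<open>The infimum need not be attained; this costs the slack \<open>1\<close> that recurs in
  the later constants.\<close>

lemma set_edist_leD:
  assumes "set_edist d A B \<le> ennreal R" "0 \<le> R"
  shows "\<exists>a\<in>A. \<exists>b\<in>B. d a b < R + 1"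
proof -
  have "ennreal R < ennreal (R + 1)" using assms(2) by (simp add: ennreal_less_iff)
  then show ?thesis using assms(1) by (intro set_edist_lessD) (rule le_less_trans)
qed

lemma set_edist_le: "a \<in> A \<Longrightarrow> b \<in> B \<Longrightarrow> set_edist d A B \<le> ennreal (d a b)"
  unfolding set_edist_def by (rule INF_lower2, assumption, rule INF_lower)

lemma set_ediam_leD:
  assumes "set_ediam d A \<le> ennreal R" "0 \<le> R" "a \<in> A" "b \<in> A"
  shows "d a b \<le> R"
proof -
  have "ennreal (d a b) \<le> set_ediam d A"
    unfolding set_ediam_def using assms(3,4) by (intro SUP_upper2[OF assms(3)] SUP_upper)
  then show ?thesis using assms(1,2) by (metis ennreal_le_iff order_trans)
qed

text \<open>Bounded diameters pass from an almost closest pair to arbitrary points, which is what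
  makes the choice of representatives harmless.\<close>

lemma (in Metric_space) dist_le_set_edist:
  assumes "A \<subseteq> M" "B \<subseteq> M" "set_edist d A B \<le> ennreal R" "0 \<le> R"
    and "set_ediam d A \<le> ennreal \<xi>" "set_ediam d B \<le> ennreal \<xi>'" "0 \<le> \<xi>" "0 \<le> \<xi>'"
    and "a \<in> A" "b \<in> B"
  shows "d a b \<le> R + 1 + \<xi> + \<xi>'"
proof -
  obtain a' b' where ab: "a' \<in> A" "b' \<in> B" "d a' b' < R + 1"
    using set_edist_leD[OF assms(3,4)] by blast
  have "d a a' \<le> \<xi>" "d b' b \<le> \<xi>'"
    using set_ediam_leD assms ab by metis+
  moreover have "a \<in> M" "b \<in> M" "a' \<in> M" "b' \<in> M" using ab assms by auto
  then have "d a b \<le> d a a' + d a' b" "d a' b \<le> d a' b' + d b' b"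
    using triangle by blast+
  ultimately show ?thesis using ab by linarith
qed

lemma (in Metric_space) set_ediam_singleton: "p \<in> M \<Longrightarrow> set_ediam d {p} \<le> ennreal 0"
  by (simp add: set_ediam_def)

lemma geodesic_segment_start_le:
  assumes "geodesic_segment M d a b G" "p \<in> G"
  shows "d a p \<le> d a b"
proof -
  obtain L \<gamma> where g: "L \<ge> 0" "\<gamma> 0 = a" "\<gamma> L = b" "\<gamma> ` {0..L} = G"
    "\<forall>s\<in>{0..L}. \<forall>t\<in>{0..L}. d (\<gamma> s) (\<gamma> t) = \<bar>s - t\<bar>"
    using assms(1) unfolding geodesic_segment_def by blast
  obtain t where t: "t \<in> {0..L}" "p = \<gamma> t" using g(4) assms(2) by blast
  have "d (\<gamma> 0) (\<gamma> t) = \<bar>0 - t\<bar>" "d (\<gamma> 0) (\<gamma> L) = \<bar>0 - L\<bar>" using g(1,5) t(1) by auto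
  then show ?thesis using g(1-3) t by simp
qed

lemma geodesic_segment_endpoints:
  assumes "geodesic_segment M d a b G"
  shows "a \<in> G" "b \<in> G" "G \<subseteq> M"
  using assms unfolding geodesic_segment_def by force+

section \<open>Nesting and orthogonality\<close>

context hierarchically_hyperbolic_space
begin

lemma nested_refl: "V \<in> \<S> \<Longrightarrow> V \<sqsubseteq> V"
  using nested_partial_order(1) by (rule reflp_onD)

lemma nested_trans: "U \<in> \<S> \<Longrightarrow> V \<in> \<S> \<Longrightarrow> W \<in> \<S> \<Longrightarrow> U \<sqsubseteq> V \<Longrightarrow> V \<sqsubseteq> W \<Longrightarrow> U \<sqsubseteq> W"
  using nested_partial_order(2) by (rule transp_onD)

lemma nested_antisym: "V \<in> \<S> \<Longrightarrow> W \<in> \<S> \<Longrightarrow> V \<sqsubseteq> W \<Longrightarrow> W \<sqsubseteq> V \<Longrightarrow> V = W"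
  using nested_partial_order(3) by (rule antisymp_onD)

lemma orth_sym: "V \<in> \<S> \<Longrightarrow> W \<in> \<S> \<Longrightarrow> V \<perp> W \<Longrightarrow> W \<perp> V"
  using orth_sym_irrefl(1) by (rule symp_onD)

definition nested_chains :: "'s \<Rightarrow> 's set set" where
  "nested_chains V = {A. A \<subseteq> {T \<in> \<S>. T \<sqsubseteq> V} \<and> (\<forall>T\<in>A. \<forall>T'\<in>A. T \<sqsubseteq> T' \<or> T' \<sqsubseteq> T)}"

definition height :: "'s \<Rightarrow> nat" where
  "height V = Max (card ` nested_chains V)"

text \<open>The maximum defining \<open>height\<close> is genuine for every \<open>V\<close>: finite
  complexity bounds the cardinalities, and the empty chain is always present.\<close>

lemma height_bounded: "\<exists>n. \<forall>V. (\<forall>A\<in>nested_chains V. finite A \<and> card A \<le> height V) \<and>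
    (\<exists>A\<in>nested_chains V. card A = height V) \<and> height V \<le> n"
proof -
  obtain n :: nat where n: "\<forall>A\<subseteq>\<S>. (\<forall>V\<in>A. \<forall>W\<in>A. V \<sqsubseteq> W \<or> W \<sqsubseteq> V) \<longrightarrow> finite A \<and> card A \<le> n"
    using finite_complexity by blast
  have "(\<forall>A\<in>nested_chains V. finite A \<and> card A \<le> height V) \<and>
    (\<exists>A\<in>nested_chains V. card A = height V) \<and> height V \<le> n" for V
  proof -
    have fin: "finite A \<and> card A \<le> n" if "A \<in> nested_chains V" for A
      using n that by (auto simp: nested_chains_def)
    then have "card ` nested_chains V \<subseteq> {..n}" by auto
    then have f: "finite (card ` nested_chains V)" using finite_subset by blast
    have "{} \<in> nested_chains V" by (simp add: nested_chains_def)
    then have "height V \<in> card ` nested_chains V"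
      using f unfolding height_def by (intro Max_in) auto
    then show ?thesis using fin f by (auto simp: height_def)
  qed
  then show ?thesis by blast
qed

lemma nested_chain_card: "A \<in> nested_chains V \<Longrightarrow> finite A \<and> card A \<le> height V"
  using height_bounded by blast

text \<open>A longest chain below \<open>V\<close> can be extended by \<open>W\<close>.\<close>

lemma height_less:
  assumes "V \<in> \<S>" "W \<in> \<S>" "V \<sqsubset> W"
  shows "height V < height W"
proof -
  obtain A where A: "A \<in> nested_chains V" "card A = height V" "finite A"
    using height_bounded nested_chain_card by blast
  have "W \<notin> A" "insert W A \<in> nested_chains W"
    using A(1) assms nested_refl nested_trans nested_antisym
    unfolding nested_chains_def properly_nested_def by blast+
  then have "card (insert W A) \<le> height W" "card (insert W A) = Suc (height V)"
    using nested_chain_card[of "insert W A" W] A by auto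
  then show ?thesis by simp
qed

lemma height_pos:
  assumes "V \<in> \<S>"
  shows "0 < height V"
proof -
  have "{V} \<in> nested_chains V" using assms nested_refl by (simp add: nested_chains_def)
  then show ?thesis using nested_chain_card[of "{V}" V] by simp
qed

text \<open>The axiom gives only a unique maximal domain. Bounded height puts every domain below
  some maximal one, which by uniqueness is \<open>U\<close>.\<close>

lemma greatest_domain: "\<S> \<noteq> {} \<Longrightarrow> \<exists>U\<in>\<S>. \<forall>V\<in>\<S>. V \<sqsubseteq> U"
proof -
  assume "\<S> \<noteq> {}"
  then obtain U where U: "U \<in> \<S>" "\<And>W. W \<in> \<S> \<Longrightarrow> (\<forall>V\<in>\<S>. W \<sqsubseteq> V \<longrightarrow> V = W) \<Longrightarrow> W = U"
    using nested_maximal by auto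
  obtain n where n: "\<And>V. height V \<le> n" using height_bounded by blast
  have "V \<sqsubseteq> U" if V: "V \<in> \<S>" for V
  proof -
    obtain W where W: "W \<in> \<S> \<and> V \<sqsubseteq> W" "\<forall>T. T \<in> \<S> \<and> V \<sqsubseteq> T \<longrightarrow> height T \<le> height W"
      using ex_has_greatest_nat[of "\<lambda>T. T \<in> \<S> \<and> V \<sqsubseteq> T" V height "Suc n"] V nested_refl n
      by (auto simp: less_Suc_eq_le)
    have "T = W" if "T \<in> \<S>" "W \<sqsubseteq> T" for T
    proof (rule ccontr)
      assume "T \<noteq> W"
      then have "height W < height T"
        using height_less W that by (auto simp: properly_nested_def)
      moreover have "V \<sqsubseteq> T" using nested_trans V W that by blast
      ultimately show False using W that by fastforce
    qed
    then show ?thesis using U(2) W by blast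
  qed
  then show ?thesis using U by blast
qed

text \<open>Containers produce a nested chain as long as the orthogonal family.\<close>

lemma card_orthogonal_le_height:
  assumes "finite J" "T \<in> \<S>" "J \<subseteq> {V \<in> \<S>. V \<sqsubseteq> T}" "pairwise (\<perp>) J"
  shows "card J \<le> height T"
  using assms
proof (induction J arbitrary: T)
  case (insert U J)
  show ?case
  proof (cases "J = {}")
    case True
    then show ?thesis using height_pos[OF insert.prems(1)] by simp
  next
    case False
    have ort: "V \<perp> U" if "V \<in> J" for V
      using insert that by (auto simp: pairwise_insert)
    then have "{V \<in> \<S>. V \<sqsubseteq> T \<and> V \<perp> U} \<noteq> {}" using False insert.prems(2) by blast
    then obtain W where W: "W \<in> \<S>" "W \<sqsubset> T" "\<forall>V\<in>\<S>. V \<perp> U \<and> V \<sqsubseteq> T \<longrightarrow> V \<sqsubseteq> W"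
      using orth_container[of T U] insert.prems by auto
    \<comment> \<open>All of \<open>J\<close> lies in the container \<open>W\<close>; its smaller
      height pays for \<open>U\<close>.\<close>
    have "card J \<le> height W"
      using W ort insert.prems by (intro insert.IH) (auto simp: pairwise_insert)
    then show ?thesis
      using height_less[OF W(1) insert.prems(1) W(2)] insert.hyps by simp
  qed
qed simp

end

section \<open>Hierarchically hyperbolic spaces as coarse projections\<close>

locale hhs_coordinates = hierarchically_hyperbolic_space graph_type H \<delta> \<xi> \<kappa>\<^sub>0 E
  for graph_type :: "'g itself" and H :: "('x, 's, 'c, 'z) hhs_data_scheme" (structure)
    and \<delta> \<xi> \<kappa>\<^sub>0 E +
  fixes lam :: "'s \<Rightarrow> 'x \<Rightarrow> 'c" and \<epsilon> :: real
  assumes normalised: "normalised H"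
    and lam: "U \<in> \<S> \<Longrightarrow> x \<in> \<X> \<Longrightarrow> lam U x \<in> \<pi> U x"
    and eps_nonneg: "\<epsilon> \<ge> 0"
    and eps_large: "x \<in> \<X> \<Longrightarrow> U \<in> \<S> \<Longrightarrow> V \<in> \<S> \<Longrightarrow> U \<noteq> V \<Longrightarrow>
          (lam U x, lam V x) \<in> consistent_pairs H \<epsilon> U V"
begin

abbreviation "\<Y> \<equiv> consistent_tuples H \<epsilon>"

text \<open>Meaningful for \<open>V\<close> properly nested in or transverse to \<open>W\<close>,
  where the diameter bound makes the choice immaterial up to \<open>\<xi>\<close>.\<close>

definition rho_point :: "'s \<Rightarrow> 's \<Rightarrow> 'c" where
  "rho_point V W = (SOME p. p \<in> \<rho> V W)"

lemma E_nonneg: "0 \<le> E"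
  using E_ge constants_nonneg by simp

lemma factor_metric: "W \<in> \<S> \<Longrightarrow> Metric_space (\<C> W) (dist W)"
  using factor_hyperbolic by (simp add: hyperbolic_geodesic_space_def)

lemma lam_in: "x \<in> \<X> \<Longrightarrow> W \<in> \<S> \<Longrightarrow> lam W x \<in> \<C> W"
  using lam proj_nonempty by blast

lemma tuple_in: "b \<in> \<Y> \<Longrightarrow> W \<in> \<S> \<Longrightarrow> b W \<in> \<C> W"
  by (auto simp: consistent_tuples_def)

lemma product_map_apply: "W \<in> \<S> \<Longrightarrow> product_map H lam x W = lam W x"
  by (simp add: product_map_def)

lemma product_map_tuple: "x \<in> \<X> \<Longrightarrow> product_map H lam x \<in> \<Y>"
  using eps_large lam_in by (auto simp: consistent_tuples_def product_map_def)

lemma rho_props: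
  assumes "V \<in> \<S>" "W \<in> \<S>" "V \<sqsubset> W \<or> V \<pitchfork> W"
  shows "\<rho> V W \<subseteq> \<C> W" "set_ediam (dist W) (\<rho> V W) \<le> ennreal \<xi>" "rho_point V W \<in> \<rho> V W"
    "rho_point V W \<in> \<C> W"
proof -
  have "\<rho> V W \<noteq> {} \<and> \<rho> V W \<subseteq> \<C> W \<and> set_ediam (dist W) (\<rho> V W) \<le> ennreal \<xi>"
    using assms rho_nested rho_transverse by blast
  moreover from this show "rho_point V W \<in> \<rho> V W"
    unfolding rho_point_def by (simp add: some_in_eq)
  ultimately show "\<rho> V W \<subseteq> \<C> W" "set_ediam (dist W) (\<rho> V W) \<le> ennreal \<xi>"
    "rho_point V W \<in> \<C> W" by auto
qed

lemma rho_iff: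
  assumes "V \<in> \<S>" "W \<in> \<S>"
  shows "V \<noteq> W \<and> \<not> V \<perp> W \<and> \<not> W \<sqsubseteq> V \<longleftrightarrow> V \<sqsubset> W \<or> V \<pitchfork> W"
  using orth_incomparable nested_antisym assms
  unfolding transverse_def properly_nested_def by blast

lemma dist_rho_point:
  assumes "V \<in> \<S>" "W \<in> \<S>" "V \<sqsubset> W \<or> V \<pitchfork> W" "p \<in> \<C> W" "0 \<le> R"
    and "set_edist (dist W) {p} (\<rho> V W) \<le> ennreal R"
  shows "dist W p (rho_point V W) \<le> R + 1 + \<xi>"
  using Metric_space.dist_le_set_edist[OF factor_metric[OF assms(2)], of "{p}" "\<rho> V W" R 0 \<xi>]
    Metric_space.set_ediam_singleton[OF factor_metric[OF assms(2)] assms(4)]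
    rho_props[OF assms(1-3)] assms constants_nonneg by simp

lemma dist_lam:
  assumes "W \<in> \<S>" "x \<in> \<X>" "A \<subseteq> \<C> W" "0 \<le> R" "set_edist (dist W) (\<pi> W x) A \<le> ennreal R"
    and "set_ediam (dist W) A \<le> ennreal \<xi>" "a \<in> A"
  shows "dist W (lam W x) a \<le> R + 1 + 2 * \<xi>"
  using Metric_space.dist_le_set_edist[OF factor_metric[OF assms(1)], of "\<pi> W x" A R \<xi> \<xi> "lam W x" a]
    proj_nonempty proj_diam lam assms constants_nonneg by simp

lemma dist_lam_lam:
  assumes "W \<in> \<S>" "x \<in> \<X>" "y \<in> \<X>" "0 \<le> R" "set_edist (dist W) (\<pi> W x) (\<pi> W y) \<le> ennreal R"
  shows "dist W (lam W x) (lam W y) \<le> R + 1 + 2 * \<xi>"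
  using dist_lam[OF assms(1,2) _ assms(4,5)] proj_nonempty proj_diam lam assms by simp

lemma consistent_pair:
  assumes "b \<in> \<Y>" "V \<in> \<S>" "W \<in> \<S>" "V \<noteq> W"
  shows "(b V, b W) \<in> consistent_pairs H \<epsilon> V W"
  using assms by (simp add: consistent_tuples_def)

lemma behrstock_tuple:
  assumes b: "b \<in> \<Y>" and V: "V \<in> \<S>" and W: "W \<in> \<S>" and t: "V \<pitchfork> W"
  shows "dist W (b W) (rho_point V W) \<le> \<epsilon> + 1 + \<xi> \<or> dist V (b V) (rho_point W V) \<le> \<epsilon> + 1 + \<xi>"
proof -
  have t': "W \<pitchfork> V" using t V W orth_sym by (auto simp: transverse_def)
  have "min (set_edist (dist V) {b V} (\<rho> W V)) (set_edist (dist W) {b W} (\<rho> V W)) \<le> ennreal \<epsilon>"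
    using consistent_pair[OF b V W] t by (auto simp: consistent_pairs_def transverse_def)
  then consider "set_edist (dist V) {b V} (\<rho> W V) \<le> ennreal \<epsilon>"
    | "set_edist (dist W) {b W} (\<rho> V W) \<le> ennreal \<epsilon>"
    by (auto simp: min_le_iff_disj)
  then show ?thesis
    using dist_rho_point t t' V W tuple_in b eps_nonneg by cases blast+
qed

text \<open>If \<open>b W\<close> is that far from the relative projection, a geodesic from
  \<open>b W\<close> to \<open>b' W\<close> stays outside its \<open>E\<close>-neighbourhood. So the
  images of the endpoints under \<open>\<rho>map W V\<close> are \<open>E\<close>-close, and
  consistency puts \<open>b V\<close> and \<open>b' V\<close> within \<open>\<epsilon>\<close> of
  them.\<close>

lemma geodesic_image_tuple:
  assumes b: "b \<in> \<Y>" "b' \<in> \<Y>" and V: "V \<in> \<S>" and W: "W \<in> \<S>" and VW: "V \<sqsubset> W"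
  shows "dist V (b V) (b' V) \<le> 2 * \<epsilon> + E \<or>
    dist W (b W) (rho_point V W) \<le> dist W (b W) (b' W) + (\<epsilon> + E + 1 + \<xi>)"
proof (rule disjCI)
  assume far: "\<not> dist W (b W) (rho_point V W) \<le> dist W (b W) (b' W) + (\<epsilon> + E + 1 + \<xi>)"
  interpret V: Metric_space "\<C> V" "dist V" using factor_metric V by blast
  interpret W: Metric_space "\<C> W" "dist W" using factor_metric W by blast
  have mem: "b V \<in> \<C> V" "b' V \<in> \<C> V" "b W \<in> \<C> W" "b' W \<in> \<C> W" "rho_point V W \<in> \<C> W"
    using b V W VW tuple_in rho_props by auto
  have tri: "dist W (b W) (rho_point V W) \<le> dist W (b W) (b' W) + dist W (b' W) (rho_point V W)"
    using W.triangle mem by blast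
  have diam: "set_ediam (dist V) ({a V} \<union> \<rho>map W V (a W)) \<le> ennreal \<epsilon>"
    if a: "a \<in> \<Y>" "\<epsilon> + 1 + \<xi> < dist W (a W) (rho_point V W)" for a
  proof -
    have "min (set_edist (dist W) {a W} (\<rho> V W))
              (set_ediam (dist V) ({a V} \<union> \<rho>map W V (a W))) \<le> ennreal \<epsilon>"
      using consistent_pair[OF a(1) V W] VW by (auto simp: consistent_pairs_def properly_nested_def)
    moreover have "\<not> set_edist (dist W) {a W} (\<rho> V W) \<le> ennreal \<epsilon>"
      using dist_rho_point[OF V W _ tuple_in[OF a(1) W] eps_nonneg] VW a(2) by fastforce
    ultimately show ?thesis by (auto simp: min_le_iff_disj)
  qed
  have d: "set_ediam (dist V) ({b V} \<union> \<rho>map W V (b W)) \<le> ennreal \<epsilon>"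
    "set_ediam (dist V) ({b' V} \<union> \<rho>map W V (b' W)) \<le> ennreal \<epsilon>"
    using far tri W.nonneg E_nonneg by (intro diam b; smt (verit))+
  obtain G where G: "geodesic_segment (\<C> W) (dist W) (b W) (b' W) G"
    using factor_hyperbolic[OF W] mem unfolding hyperbolic_geodesic_space_def by blast
  have "\<not> set_edist (dist W) {p} (\<rho> V W) \<le> ennreal E" if p: "p \<in> G" for p
  proof
    assume near: "set_edist (dist W) {p} (\<rho> V W) \<le> ennreal E"
    have pM: "p \<in> \<C> W" using geodesic_segment_endpoints(3)[OF G] p by blast
    have "dist W p (rho_point V W) \<le> E + 1 + \<xi>"
      using dist_rho_point[OF V W _ pM E_nonneg near] VW by blast
    moreover have "dist W (b W) p \<le> dist W (b W) (b' W)"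
      using geodesic_segment_start_le[OF G p] .
    moreover have "dist W (b W) (rho_point V W) \<le> dist W (b W) p + dist W p (rho_point V W)"
      using W.triangle mem pM by blast
    ultimately show False using far eps_nonneg by linarith
  qed
  then have D: "set_ediam (dist V) (\<Union>p\<in>G. \<rho>map W V p) \<le> ennreal E"
    using bounded_geodesic_image[OF V W VW G] by blast
  obtain q q' where q: "q \<in> \<rho>map W V (b W)" "q' \<in> \<rho>map W V (b' W)" "q \<in> \<C> V" "q' \<in> \<C> V"
    using rho_map_nested[OF V W VW] mem by blast
  have "dist V q q' \<le> E"
    using set_ediam_leD[OF D E_nonneg] q geodesic_segment_endpoints[OF G] by blast
  moreover have "dist V (b V) q \<le> \<epsilon>" "dist V q' (b' V) \<le> \<epsilon>"
    using set_ediam_leD[OF d(1) eps_nonneg] set_ediam_leD[OF d(2) eps_nonneg] q by auto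
  moreover have "dist V (b V) (b' V) \<le> dist V (b V) q + dist V q (b' V)"
    "dist V q (b' V) \<le> dist V q q' + dist V q' (b' V)"
    using V.triangle mem q by blast+
  ultimately show "dist V (b V) (b' V) \<le> 2 * \<epsilon> + E" by linarith
qed

lemma rho_point_nested:
  assumes "U \<in> \<S>" "V \<in> \<S>" "W \<in> \<S>" "U \<sqsubseteq> V" "V \<pitchfork> W" "U \<pitchfork> W"
  shows "dist W (rho_point U W) (rho_point V W) \<le> \<kappa>\<^sub>0 + 1 + 2 * \<xi>"
proof -
  have "\<not> W \<perp> U" using assms orth_sym by (auto simp: transverse_def)
  then have "set_edist (dist W) (\<rho> U W) (\<rho> V W) \<le> ennreal \<kappa>\<^sub>0"
    using consistency_rho assms by blast
  then show ?thesis
    using Metric_space.dist_le_set_edist[OF factor_metric[OF assms(3)], of "\<rho> U W" "\<rho> V W" \<kappa>\<^sub>0 \<xi> \<xi>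
        "rho_point U W" "rho_point V W"]
      rho_props[of U W] rho_props[of V W] assms constants_nonneg by simp
qed

text \<open>The axiom realises only coordinates in the images of the projections. Normalisation
  moves each \<open>b V\<close> to a nearby point of the image.\<close>

lemma partial_realisation_tuple:
  "\<exists>C\<ge>0. \<forall>b\<in>\<Y>. \<forall>J\<subseteq>\<S>. pairwise (\<perp>) J \<longrightarrow> (\<exists>x\<in>\<X>. \<forall>V\<in>J. dist V (lam V x) (b V) \<le> C \<and>
     (\<forall>W\<in>\<S>. V \<sqsubset> W \<or> V \<pitchfork> W \<longrightarrow> dist W (lam W x) (rho_point V W) \<le> C))"
proof -
  obtain \<alpha> where \<alpha>: "\<alpha> \<ge> 0" "\<And>J p. J \<subseteq> \<S> \<Longrightarrow> (\<forall>V\<in>J. \<forall>W\<in>J. V \<noteq> W \<longrightarrow> V \<perp> W) \<Longrightarrow>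
         (\<forall>V\<in>J. p V \<in> proj_image H V) \<Longrightarrow>
         (\<exists>x\<in>\<X>. \<forall>V\<in>J. set_edist (dist V) (\<pi> V x) {p V} \<le> ennreal \<alpha> \<and>
            (\<forall>W\<in>\<S>. V \<sqsubset> W \<or> W \<pitchfork> V \<longrightarrow>
               set_edist (dist W) (\<pi> W x) (\<rho> V W) \<le> ennreal \<alpha>))"
    using partial_realisation by blast
  obtain r where r: "r \<ge> 0" "\<And>W p. W \<in> \<S> \<Longrightarrow> p \<in> \<C> W \<Longrightarrow>
      set_edist (dist W) {p} (proj_image H W) \<le> ennreal r"
    using normalised unfolding normalised_def by blast
  \<comment> \<open>\<open>\<alpha> + 1 + 2 * \<xi>\<close> comes from \<open>dist_lam\<close>, and
    \<open>r + 1\<close> from moving \<open>b V\<close> into the image.\<close>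
  define C where "C = \<alpha> + 2 + 2 * \<xi> + r"
  have "\<exists>x\<in>\<X>. \<forall>V\<in>J. dist V (lam V x) (b V) \<le> C \<and>
     (\<forall>W\<in>\<S>. V \<sqsubset> W \<or> V \<pitchfork> W \<longrightarrow> dist W (lam W x) (rho_point V W) \<le> C)"
    if b: "b \<in> \<Y>" and J: "J \<subseteq> \<S>" "pairwise (\<perp>) J" for b J
  proof -
    have "\<exists>q. q \<in> proj_image H V \<and> dist V (b V) q < r + 1" if V: "V \<in> \<S>" for V
      using set_edist_leD[OF r(2)[OF V tuple_in[OF b V]] r(1)] by blast
    then obtain p where p: "\<And>V. V \<in> \<S> \<Longrightarrow> p V \<in> proj_image H V \<and> dist V (b V) (p V) < r + 1"
      by metis
    have "\<forall>V\<in>J. \<forall>W\<in>J. V \<noteq> W \<longrightarrow> V \<perp> W" using J(2) by (simp add: pairwise_def)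
    moreover have "\<forall>V\<in>J. p V \<in> proj_image H V" using J(1) p by auto
    ultimately obtain x where x: "x \<in> \<X>" "\<forall>V\<in>J. set_edist (dist V) (\<pi> V x) {p V} \<le> ennreal \<alpha> \<and>
      (\<forall>W\<in>\<S>. V \<sqsubset> W \<or> W \<pitchfork> V \<longrightarrow> set_edist (dist W) (\<pi> W x) (\<rho> V W) \<le> ennreal \<alpha>)"
      using \<alpha>(2)[OF J(1), of p] by blast
    have "dist V (lam V x) (b V) \<le> C" if V: "V \<in> J" for V
    proof -
      have VS: "V \<in> \<S>" using V J by blast
      interpret V: Metric_space "\<C> V" "dist V" using factor_metric VS by blast
      have pV: "p V \<in> \<C> V" using p[OF VS] proj_nonempty[OF VS] by (auto simp: proj_image_def)
      have "set_ediam (dist V) {p V} \<le> ennreal \<xi>"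
        using V.set_ediam_singleton[OF pV] constants_nonneg by (simp add: order_trans)
      then have "dist V (lam V x) (p V) \<le> \<alpha> + 1 + 2 * \<xi>"
        using dist_lam[OF VS x(1) _ \<alpha>(1), of "{p V}"] x(2) V pV by simp
      moreover have "dist V (lam V x) (b V) \<le> dist V (lam V x) (p V) + dist V (p V) (b V)"
        using V.triangle lam_in x tuple_in b pV VS by blast
      ultimately show ?thesis using p[OF VS] V.commute[of "b V"] by (simp add: C_def)
    qed
    moreover have "dist W (lam W x) (rho_point V W) \<le> C"
      if V: "V \<in> J" "W \<in> \<S>" "V \<sqsubset> W \<or> V \<pitchfork> W" for V W
    proof -
      have VS: "V \<in> \<S>" using V J by blast
      have "V \<sqsubset> W \<or> W \<pitchfork> V" using V VS orth_sym by (auto simp: transverse_def)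
      then have "set_edist (dist W) (\<pi> W x) (\<rho> V W) \<le> ennreal \<alpha>" using x V by blast
      then have "dist W (lam W x) (rho_point V W) \<le> \<alpha> + 1 + 2 * \<xi>"
        using dist_lam[OF V(2) x(1) _ \<alpha>(1)] rho_props[OF VS V(2,3)] by blast
      then show ?thesis using r by (simp add: C_def)
    qed
    ultimately show ?thesis using x(1) by blast
  qed
  moreover have "C \<ge> 0" using \<alpha> r constants_nonneg by (simp add: C_def)
  ultimately show ?thesis by blast
qed

text \<open>The distance between the sets is at most that between the chosen points, so passing to
  points only weakens the bound on the number of links.\<close>

lemma large_links_points:
  "\<exists>l\<ge>1. \<forall>W\<in>\<S>. \<forall>x\<in>\<X>. \<forall>x'\<in>\<X>. \<exists>F\<subseteq>{T \<in> \<S>. T \<sqsubset> W}. finite F \<and>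
     real (card F) \<le> l * dist W (lam W x) (lam W x') + l \<and>
     (\<forall>T\<in>\<S>. T \<sqsubset> W \<longrightarrow> (\<exists>T'\<in>F. T \<sqsubseteq> T') \<or> dist T (lam T x) (lam T x') \<le> E + 1 + 2 * \<xi>)"
proof -
  obtain l where l: "l \<ge> 1" "\<forall>W\<in>\<S>. \<forall>x\<in>\<X>. \<forall>x'\<in>\<X>.
         let N = l * enn2real (set_edist (dist W) (\<pi> W x) (\<pi> W x')) + l in
         \<exists>F. F \<subseteq> {T \<in> \<S>. T \<sqsubset> W} \<and> finite F \<and> int (card F) \<le> \<lfloor>N\<rfloor> \<and>
             (\<forall>T\<in>\<S>. T \<sqsubset> W \<longrightarrow>
                (\<exists>T'\<in>F. T \<sqsubseteq> T') \<or> set_edist (dist T) (\<pi> T x) (\<pi> T x') < ennreal E) \<and>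
             (\<forall>T'\<in>F. set_edist (dist W) (\<pi> W x) (\<rho> T' W) \<le> ennreal N)"
    using large_links by (elim exE conjE) (rule that)
  have "\<exists>F\<subseteq>{T \<in> \<S>. T \<sqsubset> W}. finite F \<and>
     real (card F) \<le> l * dist W (lam W x) (lam W x') + l \<and>
     (\<forall>T\<in>\<S>. T \<sqsubset> W \<longrightarrow> (\<exists>T'\<in>F. T \<sqsubseteq> T') \<or> dist T (lam T x) (lam T x') \<le> E + 1 + 2 * \<xi>)"
    if W: "W \<in> \<S>" and x: "x \<in> \<X>" "x' \<in> \<X>" for W x x'
  proof -
    define N where "N = l * enn2real (set_edist (dist W) (\<pi> W x) (\<pi> W x')) + l"
    obtain F where F: "F \<subseteq> {T \<in> \<S>. T \<sqsubset> W}" "finite F" "int (card F) \<le> \<lfloor>N\<rfloor>"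
      "\<forall>T\<in>\<S>. T \<sqsubset> W \<longrightarrow> (\<exists>T'\<in>F. T \<sqsubseteq> T') \<or> set_edist (dist T) (\<pi> T x) (\<pi> T x') < ennreal E"
      using l(2)[rule_format, OF W x, unfolded Let_def, folded N_def]
      by (elim exE conjE) (rule that)
    interpret W: Metric_space "\<C> W" "dist W" using factor_metric W by blast
    have near: "dist T (lam T x) (lam T x') \<le> E + 1 + 2 * \<xi>"
      if "T \<in> \<S>" "set_edist (dist T) (\<pi> T x) (\<pi> T x') < ennreal E" for T
      using dist_lam_lam[OF that(1) x E_nonneg] that(2) by simp
    have "set_edist (dist W) (\<pi> W x) (\<pi> W x') \<le> ennreal (dist W (lam W x) (lam W x'))"
      by (intro set_edist_le lam W x)
    then have "enn2real (set_edist (dist W) (\<pi> W x) (\<pi> W x')) \<le> dist W (lam W x) (lam W x')"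
      by (intro enn2real_leI W.nonneg)
    then have "N \<le> l * dist W (lam W x) (lam W x') + l" using l(1) by (simp add: N_def)
    moreover have "real (card F) \<le> N" using F(3) by linarith
    moreover have "\<forall>T\<in>\<S>. T \<sqsubset> W \<longrightarrow>
        (\<exists>T'\<in>F. T \<sqsubseteq> T') \<or> dist T (lam T x) (lam T x') \<le> E + 1 + 2 * \<xi>"
      using F(4) near by blast
    ultimately show ?thesis using F(1,2) by (intro exI[of _ F]) simp
  qed
  then show ?thesis using l(1) by blast
qed

theorem tuple_realisation:
  "\<exists>\<Theta>\<ge>0. \<forall>b\<in>\<Y>. \<exists>x\<in>\<X>. \<forall>W\<in>\<S>. dist W (lam W x) (b W) \<le> \<Theta>"
proof -
  obtain C where C: "C \<ge> 0" "\<forall>b\<in>\<Y>. \<forall>J\<subseteq>\<S>. pairwise (\<perp>) J \<longrightarrow>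
     (\<exists>x\<in>\<X>. \<forall>V\<in>J. dist V (lam V x) (b V) \<le> C \<and>
     (\<forall>W\<in>\<S>. V \<sqsubset> W \<or> V \<pitchfork> W \<longrightarrow> dist W (lam W x) (rho_point V W) \<le> C))"
    using partial_realisation_tuple by (elim exE conjE) (rule that)
  obtain l where l: "l \<ge> 1" "\<forall>W\<in>\<S>. \<forall>x\<in>\<X>. \<forall>x'\<in>\<X>. \<exists>F\<subseteq>{T \<in> \<S>. T \<sqsubset> W}. finite F \<and>
     real (card F) \<le> l * dist W (lam W x) (lam W x') + l \<and>
     (\<forall>T\<in>\<S>. T \<sqsubset> W \<longrightarrow> (\<exists>T'\<in>F. T \<sqsubseteq> T') \<or> dist T (lam T x) (lam T x') \<le> E + 1 + 2 * \<xi>)"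
    using large_links_points by (elim exE conjE) (rule that)
  obtain n where n: "\<And>V. height V \<le> n" using height_bounded by blast
  \<comment> \<open>The sum dominates every constant produced above.\<close>
  define c where "c = C + l + 2 * \<epsilon> + E + \<kappa>\<^sub>0 + 1 + 2 * \<xi>"
  note pos = C(1) l(1) eps_nonneg E_nonneg constants_nonneg
  have c: "1 \<le> c" "C \<le> c" "l \<le> c" "\<epsilon> + 1 + \<xi> \<le> c" "2 * \<epsilon> + E \<le> c" "\<epsilon> + E + 1 + \<xi> \<le> c"
    "\<kappa>\<^sub>0 + 1 + 2 * \<xi> \<le> c" "E + 1 + 2 * \<xi> \<le> c"
    unfolding c_def using pos by linarith+
  interpret coarse_projections \<X> \<S> \<C> "dist" "(\<sqsubseteq>)" "(\<perp>)" rho_point \<Y> "product_map H lam" height n c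
  proof (rule coarse_projections.intro)
    fix W show "W \<in> \<S> \<Longrightarrow> Metric_space (\<C> W) (dist W)" by (rule factor_metric)
  next
    show "1 \<le> c" by (rule c)
  next
    fix b W show "b \<in> \<Y> \<Longrightarrow> W \<in> \<S> \<Longrightarrow> b W \<in> \<C> W" by (rule tuple_in)
  next
    fix x show "x \<in> \<X> \<Longrightarrow> product_map H lam x \<in> \<Y>" by (rule product_map_tuple)
  next
    fix V show "V \<in> \<S> \<Longrightarrow> V \<sqsubseteq> V" by (rule nested_refl)
  next
    fix U V W show "U \<in> \<S> \<Longrightarrow> V \<in> \<S> \<Longrightarrow> W \<in> \<S> \<Longrightarrow> U \<sqsubseteq> V \<Longrightarrow> V \<sqsubseteq> W \<Longrightarrow> U \<sqsubseteq> W"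
      by (rule nested_trans)
  next
    fix V W show "V \<in> \<S> \<Longrightarrow> W \<in> \<S> \<Longrightarrow> V \<sqsubseteq> W \<Longrightarrow> W \<sqsubseteq> V \<Longrightarrow> V = W" by (rule nested_antisym)
  next
    show "\<S> \<noteq> {} \<Longrightarrow> \<exists>U\<in>\<S>. \<forall>V\<in>\<S>. V \<sqsubseteq> U" by (rule greatest_domain)
  next
    fix V W show "V \<in> \<S> \<Longrightarrow> W \<in> \<S> \<Longrightarrow> V \<perp> W \<Longrightarrow> W \<perp> V" by (rule orth_sym)
  next
    fix U V W show "U \<in> \<S> \<Longrightarrow> V \<in> \<S> \<Longrightarrow> W \<in> \<S> \<Longrightarrow> V \<sqsubseteq> W \<Longrightarrow> W \<perp> U \<Longrightarrow> V \<perp> U"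
      by (rule orth_nested)
  next
    fix V W show "V \<in> \<S> \<Longrightarrow> W \<in> \<S> \<Longrightarrow> V \<perp> W \<Longrightarrow> \<not> V \<sqsubseteq> W" using orth_incomparable by blast
  next
    fix V W show "V \<in> \<S> \<Longrightarrow> W \<in> \<S> \<Longrightarrow> V \<sqsubseteq> W \<Longrightarrow> V \<noteq> W \<Longrightarrow> height V < height W"
      using height_less by (simp add: properly_nested_def)
  next
    fix V show "V \<in> \<S> \<Longrightarrow> height V \<le> n" by (rule n)
  next
    fix J assume J: "J \<subseteq> \<S>" "finite J" "pairwise (\<perp>) J"
    show "card J \<le> n"
    proof (cases "\<S> = {}")
      case False
      then obtain U where "U \<in> \<S>" "\<forall>V\<in>\<S>. V \<sqsubseteq> U" using greatest_domain by blast
      then have "card J \<le> height U" using J by (intro card_orthogonal_le_height) auto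
      then show ?thesis using n[of U] by simp
    qed (use J in auto)
  next
    fix V W assume "V \<in> \<S>" "W \<in> \<S>" "V \<noteq> W" "\<not> V \<perp> W" "\<not> W \<sqsubseteq> V"
    then show "rho_point V W \<in> \<C> W" using rho_iff[of V W] rho_props(4)[of V W] by blast
  next
    fix b V W assume *: "b \<in> \<Y>" "V \<in> \<S>" "W \<in> \<S>" "V \<noteq> W" "\<not> V \<perp> W" "\<not> V \<sqsubseteq> W" "\<not> W \<sqsubseteq> V"
    then have "V \<pitchfork> W" by (simp add: transverse_def)
    then show "dist W (b W) (rho_point V W) \<le> c \<or> dist V (b V) (rho_point W V) \<le> c"
      using behrstock_tuple[OF *(1-3)] c(4) by linarith
  next
    fix b b' V W assume *: "b \<in> \<Y>" "b' \<in> \<Y>" "V \<in> \<S>" "W \<in> \<S>" "V \<sqsubseteq> W" "V \<noteq> W"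
    then have "V \<sqsubset> W" by (simp add: properly_nested_def)
    then show "dist V (b V) (b' V) \<le> c \<or> dist W (b W) (rho_point V W) \<le> dist W (b W) (b' W) + c"
      using geodesic_image_tuple[OF *(1-4)] c(5,6) by linarith
  next
    fix U V W assume *: "U \<in> \<S>" "V \<in> \<S>" "W \<in> \<S>" "U \<sqsubseteq> V"
      "V \<noteq> W" "\<not> V \<perp> W" "\<not> V \<sqsubseteq> W" "\<not> W \<sqsubseteq> V" "U \<noteq> W" "\<not> U \<perp> W" "\<not> U \<sqsubseteq> W" "\<not> W \<sqsubseteq> U"
    then have "V \<pitchfork> W" "U \<pitchfork> W" by (simp_all add: transverse_def)
    then show "dist W (rho_point U W) (rho_point V W) \<le> c"
      using rho_point_nested[OF *(1-4)] c(7) by linarith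
  next
    fix b J assume *: "b \<in> \<Y>" "J \<subseteq> \<S>" "pairwise (\<perp>) J"
    obtain x where x: "x \<in> \<X>" "\<forall>V\<in>J. dist V (lam V x) (b V) \<le> C \<and>
     (\<forall>W\<in>\<S>. V \<sqsubset> W \<or> V \<pitchfork> W \<longrightarrow> dist W (lam W x) (rho_point V W) \<le> C)"
      using C(2) * by blast
    have "dist V (product_map H lam x V) (b V) \<le> c" if "V \<in> J" for V
    proof -
      have "V \<in> \<S>" using that * by blast
      then show ?thesis using that x c(2) by (fastforce simp: product_map_apply)
    qed
    moreover have "dist W (product_map H lam x W) (rho_point V W) \<le> c"
      if "V \<in> J" "W \<in> \<S>" "V \<noteq> W \<and> \<not> V \<perp> W \<and> \<not> W \<sqsubseteq> V" for V W
    proof -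
      have "V \<in> \<S>" using that * by blast
      then have "V \<sqsubset> W \<or> V \<pitchfork> W" using that rho_iff by simp
      then have "dist W (lam W x) (rho_point V W) \<le> C" using x that by blast
      then show ?thesis using that c(2) by (simp add: product_map_apply)
    qed
    ultimately show "\<exists>x\<in>\<X>. \<forall>V\<in>J. dist V (product_map H lam x V) (b V) \<le> c \<and>
          (\<forall>W\<in>\<S>. V \<noteq> W \<and> \<not> V \<perp> W \<and> \<not> W \<sqsubseteq> V \<longrightarrow>
             dist W (product_map H lam x W) (rho_point V W) \<le> c)"
      using x(1) by blast
  next
    fix x x' W assume *: "x \<in> \<X>" "x' \<in> \<X>" "W \<in> \<S>"
    obtain F where F: "F \<subseteq> {T \<in> \<S>. T \<sqsubset> W}" "finite F"
      "real (card F) \<le> l * dist W (lam W x) (lam W x') + l"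
      "\<forall>T\<in>\<S>. T \<sqsubset> W \<longrightarrow> (\<exists>T'\<in>F. T \<sqsubseteq> T') \<or> dist T (lam T x) (lam T x') \<le> E + 1 + 2 * \<xi>"
      using l(2)[THEN bspec, OF *(3), THEN bspec, OF *(1), THEN bspec, OF *(2)]
      by (elim exE conjE) (rule that)
    have "0 \<le> dist W (lam W x) (lam W x')" using Metric_space.nonneg[OF factor_metric] * by blast
    then have "l * dist W (lam W x) (lam W x') + l \<le> c * dist W (lam W x) (lam W x') + c"
      using c(3) by (intro add_mono mult_right_mono)
    then have "real (card F) \<le> c * dist W (lam W x) (lam W x') + c" using F(3) by linarith
    moreover have "\<forall>T\<in>\<S>. T \<sqsubseteq> W \<and> T \<noteq> W \<longrightarrow>
        (\<exists>T'\<in>F. T \<sqsubseteq> T') \<or> dist T (lam T x) (lam T x') \<le> c"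
    proof (intro ballI impI)
      fix T assume T: "T \<in> \<S>" "T \<sqsubseteq> W \<and> T \<noteq> W"
      then have "(\<exists>T'\<in>F. T \<sqsubseteq> T') \<or> dist T (lam T x) (lam T x') \<le> E + 1 + 2 * \<xi>"
        using F(4) by (simp add: properly_nested_def)
      then show "(\<exists>T'\<in>F. T \<sqsubseteq> T') \<or> dist T (lam T x) (lam T x') \<le> c"
        using c(8) by linarith
    qed
    moreover have "F \<subseteq> {T \<in> \<S>. T \<sqsubseteq> W \<and> T \<noteq> W}"
      using F(1) unfolding properly_nested_def .
    ultimately show "\<exists>F\<subseteq>{T \<in> \<S>. T \<sqsubseteq> W \<and> T \<noteq> W}. finite F \<and>
          real (card F) \<le> c * dist W (product_map H lam x W) (product_map H lam x' W) + c \<and>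
          (\<forall>T\<in>\<S>. T \<sqsubseteq> W \<and> T \<noteq> W \<longrightarrow> (\<exists>T'\<in>F. T \<sqsubseteq> T') \<or>
             dist T (product_map H lam x T) (product_map H lam x' T) \<le> c)"
      using F(2) * by (intro exI[of _ F]) (simp add: product_map_apply)
  qed
  show ?thesis using realisation by (simp add: product_map_apply)
qed

end

section \<open>Walks and coarse paths\<close>

text \<open>Intermediate vertices get arbitrary lifts. Even a walk of length zero needs one step,
  between two lifts of the same vertex, hence \<open>Suc n\<close>. It serves both for the graph
  modelling a quasigeodesic space and for the Rips graph.\<close>

lemma relpow_transport:
  assumes "(u, v) \<in> R ^^ n" "Q x u" "Q y v"
    and step: "\<And>x y u v. Q x u \<Longrightarrow> Q y v \<Longrightarrow> u = v \<or> (u, v) \<in> R \<Longrightarrow> (x, y) \<in> T"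
    and lift: "\<And>u v. (u, v) \<in> R \<Longrightarrow> \<exists>x. Q x u"
  shows "(x, y) \<in> T ^^ Suc n"
  using assms(1,3)
proof (induction n arbitrary: v y)
  case 0
  then have "(x, y) \<in> T" using step assms(2) by auto
  then show ?case by simp
next
  case (Suc n)
  then obtain w where w: "(u, w) \<in> R ^^ n" "(w, v) \<in> R" by auto
  then obtain z where z: "Q z w" using lift by blast
  have "(x, z) \<in> T ^^ Suc n" using Suc.IH w(1) z by blast
  moreover have "(z, y) \<in> T" using step z Suc.prems(2) w(2) by blast
  ultimately show ?case by (rule relpow_Suc_I)
qed

text \<open>Steps may collapse to a point and the target relation need not have loops, so the image
  walk can be shorter.\<close>

lemma relpow_image:
  assumes "(x, y) \<in> R ^^ n" "\<And>x y. (x, y) \<in> R \<Longrightarrow> f x = f y \<or> (f x, f y) \<in> T"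
  shows "\<exists>m\<le>n. (f x, f y) \<in> T ^^ m"
  using assms(1)
proof (induction n arbitrary: y)
  case (Suc n)
  then obtain z where z: "(x, z) \<in> R ^^ n" "(z, y) \<in> R" by auto
  then obtain m where "m \<le> n" "(f x, f z) \<in> T ^^ m" using Suc.IH by blast
  then show ?case
    using assms(2)[OF z(2)] relpow_Suc_I le_SucI by (metis Suc_le_mono)
qed simp

lemma relpow_sym:
  assumes "sym R" "(x, y) \<in> R ^^ n"
  shows "(y, x) \<in> R ^^ n"
  using assms(2)
proof (induction n arbitrary: y)
  case (Suc n)
  then obtain z where "(x, z) \<in> R ^^ n" "(z, y) \<in> R" by auto
  then show ?case using Suc.IH symD[OF assms(1)] relpow_Suc_I2 by metis
qed simp

lemma graph_dist_le: "(x, y) \<in> R ^^ n \<Longrightarrow> graph_dist R x y \<le> of_nat n"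
  unfolding graph_dist_def by (rule INF_lower) simp

lemma graph_dist_attained:
  assumes "graph_dist R x y < \<infinity>"
  obtains n where "(x, y) \<in> R ^^ n" "graph_dist R x y = of_nat n"
proof -
  have ex: "\<exists>n. (x, y) \<in> R ^^ n"
    using assms by (auto simp: graph_dist_def INF_less_iff)
  define n where "n = (LEAST n. (x, y) \<in> R ^^ n)"
  have n: "(x, y) \<in> R ^^ n" unfolding n_def using ex by (rule LeastI_ex)
  have "of_nat n \<le> graph_dist R x y"
    unfolding graph_dist_def n_def by (intro INF_greatest) (simp add: Least_le)
  then show ?thesis using that n graph_dist_le[OF n] by simp
qed

lemma graph_dist_refl: "graph_dist R x x = 0"
  using graph_dist_le[of x x 0 R] by simp

lemma graph_dist_sym: "sym R \<Longrightarrow> graph_dist R x y = graph_dist R y x"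
  unfolding graph_dist_def using relpow_sym[of R] by (metis (lifting))

lemma graph_dist_triangle: "graph_dist R x z \<le> graph_dist R x y + graph_dist R y z"
proof (cases "graph_dist R x y < \<infinity> \<and> graph_dist R y z < \<infinity>")
  case True
  then obtain m n where "(x, y) \<in> R ^^ m" "graph_dist R x y = of_nat m"
    "(y, z) \<in> R ^^ n" "graph_dist R y z = of_nat n"
    using graph_dist_attained by metis
  then show ?thesis
    using graph_dist_le[of x z "m + n" R] by (auto simp: relpow_add)
next
  case False
  then have "graph_dist R x y = \<infinity> \<or> graph_dist R y z = \<infinity>" by (metis infinity_ennreal_def top.not_eq_extremum)
  then show ?thesis by auto
qed

definition coarse_steps :: "real \<Rightarrow> 'a set \<Rightarrow> ('a \<Rightarrow> 'a \<Rightarrow> real) \<Rightarrow> ('a \<times> 'a) set" where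
  "coarse_steps R M d = {(x, y). x \<in> M \<and> y \<in> M \<and> d x y \<le> R}"

lemma (in Metric_space) coarse_steps_dist:
  assumes "(x, y) \<in> coarse_steps R M d ^^ n" "x \<in> M"
  shows "d x y \<le> real n * R"
  using assms(1)
proof (induction n arbitrary: y)
  case 0
  then show ?case using assms(2) by simp
next
  case (Suc n)
  then obtain z where z: "(x, z) \<in> coarse_steps R M d ^^ n" "z \<in> M" "y \<in> M" "d z y \<le> R"
    by (auto simp: coarse_steps_def)
  have "d x y \<le> d x z + d z y" using triangle assms(2) z by blast
  then show ?case using Suc.IH[OF z(1)] z(4) by (simp add: algebra_simps)
qed

text \<open>A shortest walk between the images in the graph is lifted by coarse surjectivity; it
  exists because distances in \<open>M\<close> are finite.\<close>

lemma quasigeodesic_coarse_steps: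
  assumes "quasigeodesic TYPE('g) M (\<lambda>x y. ennreal (d x y))" and nonneg: "\<And>x y. 0 \<le> d x y"
  shows "\<exists>R\<ge>0. \<exists>C\<ge>0. \<forall>x\<in>M. \<forall>y\<in>M. \<exists>n.
    (x, y) \<in> coarse_steps R M d ^^ n \<and> real n \<le> C * d x y + C"
proof -
  obtain V :: "'g set" and edges f where G: "simple_graph V edges"
    and qi: "quasi_isometry M (\<lambda>x y. ennreal (d x y)) V (graph_dist edges) f"
    using assms(1) unfolding quasigeodesic_def by blast
  obtain A B where AB: "A \<ge> 1" "B \<ge> 0"
    "\<And>x y. x \<in> M \<Longrightarrow> y \<in> M \<Longrightarrow>
       ennreal (d x y) / ennreal A - ennreal B \<le> graph_dist edges (f x) (f y)"
    "\<And>x y. x \<in> M \<Longrightarrow> y \<in> M \<Longrightarrow>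
       graph_dist edges (f x) (f y) \<le> ennreal A * ennreal (d x y) + ennreal B"
    "\<And>z. z \<in> V \<Longrightarrow> \<exists>x\<in>M. graph_dist edges (f x) z \<le> ennreal B"
    using qi unfolding quasi_isometry_def by blast
  \<comment> \<open>Lifts of equal or adjacent vertices have images within \<open>2 * B + 1\<close>;
    the lower quasi-isometry bound adds \<open>B\<close> and multiplies by \<open>A\<close>.\<close>
  define R where "R = A * (3 * B + 1)"
  define near where "near x v \<longleftrightarrow> x \<in> M \<and> graph_dist edges (f x) v \<le> ennreal B" for x v
  have step: "(x, y) \<in> coarse_steps R M d"
    if x: "near x u" and y: "near y v" and e: "u = v \<or> (u, v) \<in> edges" for x y u v
  proof -
    have M: "x \<in> M" "y \<in> M" using x y by (auto simp: near_def)
    have uv: "graph_dist edges u v \<le> 1"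
      using e graph_dist_refl[of edges] graph_dist_le[of u v 1 edges] by auto
    have "graph_dist edges v (f y) \<le> ennreal B"
      using y graph_dist_sym[of edges v "f y"] G by (simp add: near_def simple_graph_def)
    moreover have "graph_dist edges (f x) u \<le> ennreal B" using x by (simp add: near_def)
    moreover have "graph_dist edges (f x) (f y) \<le>
        graph_dist edges (f x) u + (graph_dist edges u v + graph_dist edges v (f y))"
      by (meson add_left_mono graph_dist_triangle order_trans)
    ultimately have "graph_dist edges (f x) (f y) \<le> ennreal B + (1 + ennreal B)"
      using uv by (meson add_mono order_trans)
    also have "\<dots> = ennreal (2 * B + 1)"
      using AB(2) by (simp flip: ennreal_plus ennreal_1)
    finally have "ennreal (d x y / A - B) \<le> ennreal (2 * B + 1)"
      using AB(3)[OF M] AB(1,2) nonneg by (simp add: divide_ennreal ennreal_minus)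
    then have "d x y / A - B \<le> 2 * B + 1"
      using AB(2) ennreal_le_iff[of "2 * B + 1"] by (simp del: ennreal_plus)
    then have "d x y / A \<le> 3 * B + 1" by simp
    then have "d x y \<le> R" using AB(1) by (simp add: R_def field_simps)
    then show ?thesis using M by (simp add: coarse_steps_def)
  qed
  have lift: "\<exists>x. near x u" if "(u, v) \<in> edges" for u v
    using that G AB(5) unfolding simple_graph_def near_def by blast
  have "\<exists>n. (x, y) \<in> coarse_steps R M d ^^ n \<and> real n \<le> (A + B + 1) * d x y + (A + B + 1)"
    if M: "x \<in> M" "y \<in> M" for x y
  proof -
    have le: "graph_dist edges (f x) (f y) \<le> ennreal (A * d x y + B)"
      using AB(4)[OF M] AB(1,2) nonneg by (simp add: ennreal_plus ennreal_mult)
    then obtain n where n: "(f x, f y) \<in> edges ^^ n" "graph_dist edges (f x) (f y) = of_nat n"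
      by (metis graph_dist_attained ennreal_less_top infinity_ennreal_def order_le_less_trans)
    have "ennreal (real n) \<le> ennreal (A * d x y + B)" using le n(2) by (simp add: ennreal_of_nat_eq_real_of_nat)
    then have "real n \<le> A * d x y + B" using AB(1,2) nonneg by (simp add: ennreal_le_iff del: ennreal_plus)
    moreover have "A * d x y \<le> (A + B + 1) * d x y" using AB nonneg by (intro mult_right_mono) auto
    ultimately have "real (Suc n) \<le> (A + B + 1) * d x y + (A + B + 1)" using AB(1) by simp
    moreover have "near x (f x)" "near y (f y)" using M by (simp_all add: near_def graph_dist_refl)
    then have "(x, y) \<in> coarse_steps R M d ^^ Suc n"
      using relpow_transport[OF n(1), of near x y] step lift by blast
    ultimately show ?thesis by blast
  qed
  moreover have "0 \<le> R" "0 \<le> A + B + 1" using AB by (auto simp: R_def)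
  ultimately show ?thesis by blast
qed

section \<open>The quasi-isometry\<close>

context hhs_coordinates
begin

lemma linf_dist_le_iff:
  "0 \<le> R \<Longrightarrow> linf_dist H y z \<le> ennreal R \<longleftrightarrow> (\<forall>W\<in>\<S>. dist W (y W) (z W) \<le> R)"
  by (simp add: linf_dist_def SUP_le_iff ennreal_le_iff)

lemma lam_coarsely_lipschitz:
  "\<exists>K\<ge>0. \<forall>W\<in>\<S>. \<forall>x\<in>\<X>. \<forall>y\<in>\<X>. dist W (lam W x) (lam W y) \<le> K * total_dist H x y + K"
proof -
  obtain K where K: "K \<ge> 0" "\<And>W x y. W \<in> \<S> \<Longrightarrow> x \<in> \<X> \<Longrightarrow> y \<in> \<X> \<Longrightarrow>
      set_edist (dist W) (\<pi> W x) (\<pi> W y) \<le> ennreal (K * total_dist H x y + K)"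
    using proj_lipschitz_quasiconvex by blast
  interpret X: Metric_space \<X> "total_dist H" by (rule total_metric)
  define K' where "K' = K + 1 + 2 * \<xi>"
  have "dist W (lam W x) (lam W y) \<le> K' * total_dist H x y + K'"
    if "W \<in> \<S>" "x \<in> \<X>" "y \<in> \<X>" for W x y
  proof -
    have "dist W (lam W x) (lam W y) \<le> K * total_dist H x y + K + 1 + 2 * \<xi>"
      using dist_lam_lam[OF that _ K(2)[OF that]] K(1) X.nonneg by simp
    moreover have "K * total_dist H x y \<le> K' * total_dist H x y"
      using constants_nonneg X.nonneg by (intro mult_right_mono) (auto simp: K'_def)
    ultimately show ?thesis by (simp add: K'_def)
  qed
  moreover have "0 \<le> K'" using K constants_nonneg by (simp add: K'_def)
  ultimately show ?thesis by blast
qed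

text \<open>Contrapositive of the uniqueness axiom. The maximum with zero admits negative
  \<open>R\<close>, and adding \<open>1\<close> makes the contradiction strict.\<close>

lemma total_dist_bounded:
  "\<exists>Q\<ge>0. \<forall>x\<in>\<X>. \<forall>y\<in>\<X>. (\<forall>W\<in>\<S>. dist W (lam W x) (lam W y) \<le> R) \<longrightarrow> total_dist H x y \<le> Q"
proof -
  obtain \<theta> where \<theta>: "\<forall>x\<in>\<X>. \<forall>y\<in>\<X>. total_dist H x y \<ge> \<theta> \<longrightarrow>
      (\<exists>V\<in>\<S>. set_edist (dist V) (\<pi> V x) (\<pi> V y) \<ge> ennreal (max 0 R + 1))"
    using uniqueness[of "max 0 R + 1"] by auto
  have "total_dist H x y \<le> max 0 \<theta>"
    if x: "x \<in> \<X>" "y \<in> \<X>" and R: "\<forall>W\<in>\<S>. dist W (lam W x) (lam W y) \<le> R" for x y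
  proof (rule ccontr)
    assume "\<not> ?thesis"
    then obtain V where V: "V \<in> \<S>" "ennreal (max 0 R + 1) \<le> set_edist (dist V) (\<pi> V x) (\<pi> V y)"
      using \<theta> x by fastforce
    note V(2)
    also have "set_edist (dist V) (\<pi> V x) (\<pi> V y) \<le> ennreal (dist V (lam V x) (lam V y))"
      using V(1) x by (intro set_edist_le lam)
    also have "\<dots> \<le> ennreal (max 0 R)" using R V by (intro ennreal_leI) fastforce
    finally show False by (simp add: ennreal_le_iff)
  qed
  then show ?thesis by (intro exI[of _ "max 0 \<theta>"]) auto
qed

theorem product_map_quasi_isometry:
  "\<exists>\<sigma>\<^sub>0\<ge>0. \<forall>\<sigma>\<ge>\<sigma>\<^sub>0. quasi_isometry \<X> (\<lambda>x y. ennreal (total_dist H x y))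
     \<Y> (rips_dist \<sigma> \<Y> (linf_dist H)) (product_map H lam)"
proof -
  interpret X: Metric_space \<X> "total_dist H" by (rule total_metric)
  obtain \<Theta> where \<Theta>: "\<Theta> \<ge> 0" "\<And>b. b \<in> \<Y> \<Longrightarrow> \<exists>x\<in>\<X>. \<forall>W\<in>\<S>. dist W (lam W x) (b W) \<le> \<Theta>"
    using tuple_realisation by blast
  obtain R C where R: "R \<ge> 0" "C \<ge> 0" "\<And>x y. x \<in> \<X> \<Longrightarrow> y \<in> \<X> \<Longrightarrow> \<exists>n.
      (x, y) \<in> coarse_steps R \<X> (total_dist H) ^^ n \<and> real n \<le> C * total_dist H x y + C"
    using quasigeodesic_coarse_steps[OF total_quasigeodesic X.nonneg] by blast
  obtain K where K: "K \<ge> 0" "\<And>W x y. W \<in> \<S> \<Longrightarrow> x \<in> \<X> \<Longrightarrow> y \<in> \<X> \<Longrightarrow>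
      dist W (lam W x) (lam W y) \<le> K * total_dist H x y + K"
    using lam_coarsely_lipschitz by blast
  \<comment> \<open>\<open>\<Theta>\<close> joins a tuple by an edge to the image of a realising
    point, unless they coincide; \<open>K * R + K\<close> turns coarse steps of size
    \<open>R\<close> into edges or single vertices.\<close>
  define \<sigma>\<^sub>0 where "\<sigma>\<^sub>0 = max \<Theta> (K * R + K)"
  have "quasi_isometry \<X> (\<lambda>x y. ennreal (total_dist H x y))
     \<Y> (rips_dist \<sigma> \<Y> (linf_dist H)) (product_map H lam)" if \<sigma>: "\<sigma> \<ge> \<sigma>\<^sub>0" for \<sigma>
  proof -
    let ?f = "product_map H lam" and ?E = "rips_edges \<sigma> \<Y> (linf_dist H)"
    have \<sigma>': "\<Theta> \<le> \<sigma>" "K * R + K \<le> \<sigma>" "0 \<le> \<sigma>" using \<sigma> \<Theta>(1) by (auto simp: \<sigma>\<^sub>0_def)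
    have edge: "(y, z) \<in> ?E \<longleftrightarrow> y \<in> \<Y> \<and> z \<in> \<Y> \<and> y \<noteq> z \<and> (\<forall>W\<in>\<S>. dist W (y W) (z W) \<le> \<sigma>)" for y z
      using linf_dist_le_iff[OF \<sigma>'(3)] by (auto simp: rips_edges_def)
    obtain Q where Q: "Q \<ge> 0" "\<And>x y. x \<in> \<X> \<Longrightarrow> y \<in> \<X> \<Longrightarrow>
        \<forall>W\<in>\<S>. dist W (lam W x) (lam W y) \<le> 2 * \<Theta> + \<sigma> \<Longrightarrow> total_dist H x y \<le> Q"
      \<comment> \<open>Two realisation errors and one Rips edge; \<open>Q\<close> depends on
        \<open>\<sigma>\<close>.\<close>
      using total_dist_bounded[of "2 * \<Theta> + \<sigma>"] by blast
    define A where "A = C + Q + 1"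
    have A: "1 \<le> A" "C \<le> A" "Q \<le> A" using R(2) Q(1) by (auto simp: A_def)
    have upper: "rips_dist \<sigma> \<Y> (linf_dist H) (?f x) (?f y) \<le> ennreal A * ennreal (total_dist H x y) + ennreal A"
      if x: "x \<in> \<X>" "y \<in> \<X>" for x y
    proof -
      have step: "?f u = ?f v \<or> (?f u, ?f v) \<in> ?E"
        if uv: "(u, v) \<in> coarse_steps R \<X> (total_dist H)" for u v
      proof -
        have X: "u \<in> \<X>" "v \<in> \<X>" "total_dist H u v \<le> R" using uv by (auto simp: coarse_steps_def)
        have "dist W (?f u W) (?f v W) \<le> \<sigma>" if "W \<in> \<S>" for W
        proof -
          have "K * total_dist H u v + K \<le> K * R + K"
            using X(3) K(1) by (intro add_right_mono mult_left_mono)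
          then show ?thesis using K(2)[OF that X(1,2)] \<sigma>' that by (simp add: product_map_apply)
        qed
        then show ?thesis using product_map_tuple X by (auto simp: edge)
      qed
      obtain n where n: "(x, y) \<in> coarse_steps R \<X> (total_dist H) ^^ n"
        "real n \<le> C * total_dist H x y + C" using R(3)[OF x] by blast
      obtain m where m: "m \<le> n" "(?f x, ?f y) \<in> ?E ^^ m"
        using relpow_image[OF n(1), of ?f ?E] step by blast
      have "C * total_dist H x y \<le> A * total_dist H x y"
        using A X.nonneg by (intro mult_right_mono)
      then have "real m \<le> A * total_dist H x y + A" using m(1) n(2) A(2) by linarith
      then have "ennreal (real m) \<le> ennreal A * ennreal (total_dist H x y) + ennreal A"
        using A(1) X.nonneg by (simp add: ennreal_leI flip: ennreal_mult ennreal_plus)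
      moreover have "rips_dist \<sigma> \<Y> (linf_dist H) (?f x) (?f y) \<le> ennreal (real m)"
        using graph_dist_le[OF m(2)] by (simp add: rips_dist_def ennreal_of_nat_eq_real_of_nat)
      ultimately show ?thesis by (rule order_trans[rotated])
    qed
    have lower: "ennreal (total_dist H x y) / ennreal A - ennreal A \<le>
        rips_dist \<sigma> \<Y> (linf_dist H) (?f x) (?f y)"
      if x: "x \<in> \<X>" "y \<in> \<X>" for x y
    proof -
      define near where "near x b \<longleftrightarrow> x \<in> \<X> \<and> b \<in> \<Y> \<and> (\<forall>W\<in>\<S>. dist W (lam W x) (b W) \<le> \<Theta>)" for x b
      have step: "(u, v) \<in> coarse_steps Q \<X> (total_dist H)"
        if u: "near u b" and v: "near v b'" and bb': "b = b' \<or> (b, b') \<in> ?E" for u v b b'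
      proof -
        have X: "u \<in> \<X>" "v \<in> \<X>" "b \<in> \<Y>" "b' \<in> \<Y>" using u v by (auto simp: near_def)
        have "dist W (lam W u) (lam W v) \<le> 2 * \<Theta> + \<sigma>" if W: "W \<in> \<S>" for W
        proof -
          interpret W: Metric_space "\<C> W" "dist W" using factor_metric W by blast
          have mem: "b W \<in> \<C> W" "b' W \<in> \<C> W" "lam W u \<in> \<C> W" "lam W v \<in> \<C> W"
            using X W tuple_in lam_in by auto
          have "dist W (b W) (b' W) \<le> \<sigma>" using bb' W mem \<sigma>'(3) by (auto simp: edge)
          moreover have "dist W (lam W u) (b W) \<le> \<Theta>" "dist W (lam W v) (b' W) \<le> \<Theta>"
            using u v W by (auto simp: near_def)
          moreover have "dist W (lam W u) (lam W v) \<le> dist W (lam W u) (b W) + dist W (b W) (lam W v)"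
            "dist W (b W) (lam W v) \<le> dist W (b W) (b' W) + dist W (lam W v) (b' W)"
            using W.triangle W.triangle' mem by blast+
          ultimately show ?thesis by linarith
        qed
        then show ?thesis using Q(2)[OF X(1,2)] X by (simp add: coarse_steps_def)
      qed
      have lift: "\<exists>u. near u b" if "(b, b') \<in> ?E" for b b'
        using \<Theta>(2) that unfolding near_def edge by blast
      have self: "near u (?f u)" if "u \<in> \<X>" for u
        using that product_map_tuple \<Theta>(1) Metric_space.mdist_zero[OF factor_metric] lam_in
        by (simp add: near_def product_map_apply)
      show ?thesis unfolding rips_dist_def graph_dist_def
      \<comment> \<open>Every walk is bounded from below, so the case of no walk, at infinite
        distance, needs no separate treatment.\<close>
      proof (rule INF_greatest)
        fix m assume "m \<in> {m. (?f x, ?f y) \<in> ?E ^^ m}"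
        then have "(?f x, ?f y) \<in> ?E ^^ m" by simp
        then have "(x, y) \<in> coarse_steps Q \<X> (total_dist H) ^^ Suc m"
          by (rule relpow_transport[where Q = near, OF _ self[OF x(1)] self[OF x(2)]])
            (rule step, assumption+, rule lift, assumption)
        then have "total_dist H x y \<le> real (Suc m) * Q" by (rule X.coarse_steps_dist) (rule x)
        also have "\<dots> \<le> real (Suc m) * A" using A by (intro mult_left_mono) auto
        finally have "total_dist H x y / A \<le> real (Suc m)" using A(1) by (simp add: field_simps)
        \<comment> \<open>The extra step from \<open>relpow_transport\<close> is absorbed by the
          additive constant, as \<open>1 \<le> A\<close>.\<close>
        then have "ennreal (total_dist H x y / A - A) \<le> ennreal (real m)"
          using A(1) by (intro ennreal_leI) simp
        then show "ennreal (total_dist H x y) / ennreal A - ennreal A \<le> of_nat m"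
          using A(1) X.nonneg
          by (simp add: divide_ennreal ennreal_minus ennreal_of_nat_eq_real_of_nat)
      qed
    qed
    have onto: "\<exists>x\<in>\<X>. rips_dist \<sigma> \<Y> (linf_dist H) (?f x) b \<le> ennreal A" if b: "b \<in> \<Y>" for b
    proof -
      obtain x where x: "x \<in> \<X>" "\<forall>W\<in>\<S>. dist W (lam W x) (b W) \<le> \<Theta>" using \<Theta>(2)[OF b] by blast
      have "\<forall>W\<in>\<S>. dist W (?f x W) (b W) \<le> \<sigma>"
        using x(2) \<sigma>'(1) by (fastforce simp: product_map_apply)
      then have "?f x = b \<or> (?f x, b) \<in> ?E" using b product_map_tuple[OF x(1)] by (simp add: edge)
      then have "rips_dist \<sigma> \<Y> (linf_dist H) (?f x) b \<le> 1"
        using graph_dist_refl[of ?E] graph_dist_le[of "?f x" b 1 ?E] by (auto simp: rips_dist_def)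
      also have "1 \<le> ennreal A" using A(1) by simp
      finally show ?thesis using x(1) by blast
    qed
    have "?f \<in> \<X> \<rightarrow> \<Y>" using product_map_tuple by blast
    moreover have "0 \<le> A" using A(1) by simp
    ultimately show ?thesis
      unfolding quasi_isometry_def using A(1) upper lower onto by blast
  qed
  moreover have "0 \<le> \<sigma>\<^sub>0" using \<Theta>(1) by (simp add: \<sigma>\<^sub>0_def)
  ultimately show ?thesis by blast
qed

end

theorem theorem1p12:
  fixes H :: "('x, 's, 'c) hhs_data"
    and lam :: "'s \<Rightarrow> 'x \<Rightarrow> 'c"
    and \<delta> \<xi> \<kappa>\<^sub>0 E \<epsilon> :: real
  assumes hhs: "hierarchically_hyperbolic_space TYPE('g) H \<delta> \<xi> \<kappa>\<^sub>0 E"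
    and normalised: "normalised H"
    and lam: "\<And>U x. U \<in> domains H \<Longrightarrow> x \<in> total_space H \<Longrightarrow> lam U x \<in> proj H U x"
    and eps_nonneg: "\<epsilon> \<ge> 0"
    and eps_large: "\<And>x U V. x \<in> total_space H \<Longrightarrow> U \<in> domains H \<Longrightarrow> V \<in> domains H \<Longrightarrow> U \<noteq> V \<Longrightarrow>
          (lam U x, lam V x) \<in> consistent_pairs H \<epsilon> U V"
  shows "\<exists>\<sigma>\<^sub>0\<ge>0. \<forall>\<sigma>\<ge>\<sigma>\<^sub>0.
           quasi_isometry
             (total_space H) (\<lambda>x y. ennreal (total_dist H x y))
             (consistent_tuples H \<epsilon>) (rips_dist \<sigma> (consistent_tuples H \<epsilon>) (linf_dist H))
             (product_map H lam)"
proof -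
  interpret hierarchically_hyperbolic_space "TYPE('g)" H \<delta> \<xi> \<kappa>\<^sub>0 E by (rule hhs)
  interpret hhs_coordinates "TYPE('g)" H \<delta> \<xi> \<kappa>\<^sub>0 E lam \<epsilon>
    by unfold_locales (use normalised lam eps_nonneg eps_large in auto)
  show ?thesis by (rule product_map_quasi_isometry)
qed

end
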